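(* Let $L=(l_1,\dots,l_m)$ be the (non-increasing) segment sequence of some unicyclic graph, with $l_1\geq 3$. (a) If $L$ contains an even entry $l_i\geq 3$, and $l_{i_0}$ is the smallest such even entry, then $\sigma(U_{i_0}(l_1,\dots,l_m))\geq \sigma(G)$ for every $G\in\mathbb{U}(l_1,\dots,l_m)$. (b) If every entry $l_i\geq 3$ of $L$ is odd, then $\sigma(U_1(l_1,\dots,l_m))\geq\sigma(G)$ for every $G\in\mathbb{U}(l_1,\dots,l_m)$. In each case, equality holds if the two compared graphs are isomorphic.
   Context: A unicyclic graph is a connected graph containing exactly one cycle. A segment of a graph $G$ is a path whose end vertices each have degree $1$ or at least $3$ in $G$ and whose internal vertices all have degree $2$ in $G$; its length is its number of edges; the segment sequence of $G$ is the non-increasing sequence of its segment lengths; $\mathbb{U}(l_1,\dots,l_m)$ is the set of unicyclic graphs with segment sequence $(l_1,\dots,l_m)$. For $l_i\geq 3$, $U_i(l_1,\dots,l_m)$ is the graph obtained from the cycle $C_{l_i}$ by attaching, at one common vertex of the cycle, pendent paths of lengths $l_j$ for all $j\neq i$ (a pendent path of length $\ell$ at $w$ consists of $\ell$ new vertices $x_1,\dots,x_\ell$ and edges $wx_1,\dots,x_{\ell-1}x_\ell$). $\sigma(G)$ (the Merrifield–Simmons index) is the number of independent vertex subsets of $G$, including the empty set. *)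

theory Defs
  imports Main "HOL-Library.Multiset"
begin

definition simple_graph :: "'a set \<Rightarrow> 'a set set \<Rightarrow> bool" where
  "simple_graph V E \<longleftrightarrow> finite V \<and>
     (\<forall>e\<in>E. \<exists>u v. e = {u, v} \<and> u \<noteq> v \<and> u \<in> V \<and> v \<in> V)"

definition adj :: "'a set set \<Rightarrow> 'a \<Rightarrow> 'a \<Rightarrow> bool" where
  "adj E u v \<longleftrightarrow> {u, v} \<in> E"

definition connected_graph :: "'a set \<Rightarrow> 'a set set \<Rightarrow> bool" where
  "connected_graph V E \<longleftrightarrow> (\<forall>u\<in>V. \<forall>v\<in>V. (adj E)\<^sup>*\<^sup>* u v)"

definition degree :: "'a set set \<Rightarrow> 'a \<Rightarrow> nat" where
  "degree E v = card {e\<in>E. v \<in> e}"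

definition is_cycle :: "'a set set \<Rightarrow> 'a set set \<Rightarrow> bool" where
  "is_cycle E C \<longleftrightarrow> (\<exists>vs. length vs \<ge> 3 \<and> distinct vs \<and>
     C = {{vs ! k, vs ! ((k + 1) mod length vs)} | k. k < length vs} \<and> C \<subseteq> E)"

definition unicyclic :: "'a set \<Rightarrow> 'a set set \<Rightarrow> bool" where
  "unicyclic V E \<longleftrightarrow> simple_graph V E \<and> V \<noteq> {} \<and> connected_graph V E \<and> (\<exists>!C. is_cycle E C)"

text \<open>A segment, given as its vertex list p = [v0,...,vk] (k = length p - 1 edges).
  Internal vertices are distinct and distinct from the end vertices; the two end vertices
  may coincide (a cycle hanging at one vertex), but then k >= 3.\<close>
definition is_segment :: "'a set set \<Rightarrow> 'a list \<Rightarrow> bool" where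
  "is_segment E p \<longleftrightarrow> length p \<ge> 2 \<and>
     (\<forall>k. k + 1 < length p \<longrightarrow> {p ! k, p ! (k + 1)} \<in> E) \<and>
     distinct (butlast p) \<and> distinct (tl p) \<and>
     (hd p = last p \<longrightarrow> length p \<ge> 4) \<and>
     (\<forall>k. 0 < k \<and> k + 1 < length p \<longrightarrow> degree E (p ! k) = 2) \<and>
     (degree E (hd p) = 1 \<or> degree E (hd p) \<ge> 3) \<and>
     (degree E (last p) = 1 \<or> degree E (last p) \<ge> 3)"

definition seg_edges :: "'a list \<Rightarrow> 'a set set" where
  "seg_edges p = {{p ! k, p ! (k + 1)} | k. k + 1 < length p}"

text \<open>Segments are identified by their edge sets (a path and its reverse are the same segment);
  the length of a segment is its number of edges.\<close>
definition segments :: "'a set set \<Rightarrow> 'a set set set" where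
  "segments E = seg_edges ` {p. is_segment E p}"

definition segment_sequence :: "'a set set \<Rightarrow> nat list \<Rightarrow> bool" where
  "segment_sequence E L \<longleftrightarrow> sorted_wrt (\<ge>) L \<and>
     mset L = image_mset card (mset_set (segments E))"

definition in_U :: "nat list \<Rightarrow> 'a set \<Rightarrow> 'a set set \<Rightarrow> bool" where
  "in_U L V E \<longleftrightarrow> unicyclic V E \<and> segment_sequence E L"

definition sigma :: "'a set \<Rightarrow> 'a set set \<Rightarrow> nat" where
  "sigma V E = card {S. S \<subseteq> V \<and> (\<forall>e\<in>E. \<not> e \<subseteq> S)}"

definition graph_iso :: "'a set \<Rightarrow> 'a set set \<Rightarrow> 'b set \<Rightarrow> 'b set set \<Rightarrow> bool" where
  "graph_iso V E V' E' \<longleftrightarrow> (\<exists>f. bij_betw f V V' \<and>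
     (\<forall>u\<in>V. \<forall>v\<in>V. {u, v} \<in> E \<longleftrightarrow> {f u, f v} \<in> E'))"

text \<open>The graph U_i(L) (index i is 0-based into the list L): cycle on vertices (0,t), t < L!i,
  with pendent paths (Suc j,1),...,(Suc j, L!j) attached at the vertex (0,0), for all j \<noteq> i.\<close>
definition pv :: "nat \<Rightarrow> nat \<Rightarrow> nat \<times> nat" where
  "pv j t = (if t = 0 then (0, 0) else (Suc j, t))"

definition U_verts :: "nat \<Rightarrow> nat list \<Rightarrow> (nat \<times> nat) set" where
  "U_verts i L = {(0, t) | t. t < L ! i} \<union>
     {(Suc j, t) | j t. j < length L \<and> j \<noteq> i \<and> 1 \<le> t \<and> t \<le> L ! j}"

definition U_edges :: "nat \<Rightarrow> nat list \<Rightarrow> (nat \<times> nat) set set" where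
  "U_edges i L = {{(0, t), (0, (t + 1) mod (L ! i))} | t. t < L ! i} \<union>
     {{pv j t, pv j (t + 1)} | j t. j < length L \<and> j \<noteq> i \<and> t < L ! j}"

end

theory Submission
  imports Defs "HOL-Number_Theory.Fib"
begin

text \<open>
  A path on \<open>l\<close> vertices has \<open>f(l) = fib (l + 2)\<close> independent sets. Attaching a pendent path of
  length \<open>l\<close> at a vertex \<open>u\<close> of \<open>H\<close> gives \<open>\<sigma>(H') = fib (l + 1) \<sigma>(H) + fib l \<sigma>(H - u)\<close>. Hence a pair
  \<open>(X, Y)\<close> with \<open>\<sigma>(H) \<le> X + Y\<close>, \<open>Y \<le> X\<close> and \<open>\<sigma>(H - u) \<le> X\<close> at every branch vertex or leaf \<open>u\<close>
  may be replaced by \<open>(X fib (l + 2), Y fib (l + 1))\<close>, wherever the path is attached. A unicyclic graph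
  grows from its cycle by attaching segments in this way, and lengthening the cycle by \<open>d\<close> obeys the
  same rule. If a segment of length \<open>l \<ge> 3\<close> lies on the cycle, starting from the cycle of length
  \<open>l\<close> yields exactly \<open>\<sigma>(U)\<close> for the graph \<open>U\<close> with that cycle. If all segments on the cycle have
  length at most 2, two or three of them already make a cycle, whose pair is so small that \<open>\<sigma>(U)\<close> is
  not exceeded for any choice of \<open>l \<ge> 3\<close>. Finally, the graphs \<open>U\<^sub>i\<close> are compared through the
  alternating ratios of consecutive Fibonacci numbers.
\<close>

section \<open>Edge sets of paths and cycles\<close>

lemma seg_edges_Nil [simp]: "seg_edges [] = {}"
  by (simp add: seg_edges_def)

lemma seg_edges_single [simp]: "seg_edges [x] = {}"
  by (simp add: seg_edges_def)

lemma seg_edges_Cons [simp]: "seg_edges (x # y # zs) = insert {x, y} (seg_edges (y # zs))"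
proof -
  have "seg_edges (x # y # zs) = (\<lambda>k. {(x # y # zs) ! k, (y # zs) ! k}) ` {..<Suc (length zs)}"
    by (auto simp: seg_edges_def)
  also have "\<dots> = insert {x, y} ((\<lambda>k. {(y # zs) ! k, zs ! k}) ` {..<length zs})"
    by (simp only: lessThan_Suc_eq_insert_0 image_insert image_image) simp
  also have "(\<lambda>k. {(y # zs) ! k, zs ! k}) ` {..<length zs} = seg_edges (y # zs)"
    by (auto simp: seg_edges_def)
  finally show ?thesis .
qed

lemma seg_edges_append:
  "xs \<noteq> [] \<Longrightarrow> ys \<noteq> [] \<Longrightarrow>
    seg_edges (xs @ ys) = insert {last xs, hd ys} (seg_edges xs \<union> seg_edges ys)"
proof (induction xs rule: induct_list012)
  case (2 x)
  then show ?case by (cases ys) auto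
qed auto

lemma seg_edges_snoc [simp]: "xs \<noteq> [] \<Longrightarrow> seg_edges (xs @ [x]) = insert {last xs, x} (seg_edges xs)"
  by (simp add: seg_edges_append)

lemma seg_edges_subset_set: "e \<in> seg_edges p \<Longrightarrow> e \<subseteq> set p"
  by (induction p rule: induct_list012) auto

lemma Union_seg_edges: "length p \<ge> 2 \<Longrightarrow> \<Union>(seg_edges p) = set p"
proof (induction p rule: induct_list012)
  case (3 x y zs)
  then show ?case by (cases zs) auto
qed auto

lemma finite_seg_edges [simp]: "finite (seg_edges p)"
  by (induction p rule: induct_list012) auto

lemma card_seg_edges: "distinct p \<Longrightarrow> card (seg_edges p) = length p - 1"
proof (induction p rule: induct_list012)
  case (3 x y zs)
  then have "{x, y} \<notin> seg_edges (y # zs)"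
    using seg_edges_subset_set by fastforce
  then show ?case using 3 by simp
qed auto

lemma seg_edges_card2: "distinct p \<Longrightarrow> e \<in> seg_edges p \<Longrightarrow> card e = 2"
  by (induction p rule: induct_list012) auto

lemma seg_edges_map_upt: "seg_edges (map f [0..<Suc l]) = {{f t, f (t + 1)} | t. t < l}"
proof (induction l)
  case (Suc l)
  have "seg_edges (map f [0..<Suc (Suc l)]) = insert {f l, f (Suc l)} (seg_edges (map f [0..<Suc l]))"
    using seg_edges_snoc[of "map f [0..<Suc l]" "f (Suc l)"] by simp
  then show ?case unfolding Suc.IH by (auto simp: less_Suc_eq)
qed simp

text \<open>The closing edge plus the path edges replace the modular indices of
  \<open>is_cycle\<close>; in this form lists can be concatenated and rotated.\<close>

definition cycle_edges :: "'a list \<Rightarrow> 'a set set" where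
  "cycle_edges vs = insert {last vs, hd vs} (seg_edges vs)"

lemma cycle_edges_nth:
  assumes "vs \<noteq> []"
  shows "{{vs ! k, vs ! ((k + 1) mod length vs)} | k. k < length vs} = cycle_edges vs"
proof -
  let ?n = "length vs"
  have n: "?n > 0" using assms by simp
  have "{{vs ! k, vs ! ((k + 1) mod ?n)} | k. k < ?n}
      = (\<lambda>k. {vs ! k, vs ! ((k + 1) mod ?n)}) ` {..<Suc (?n - 1)}"
    using n by auto
  also have "\<dots> = insert {last vs, hd vs} ((\<lambda>k. {vs ! k, vs ! ((k + 1) mod ?n)}) ` {..<?n - 1})"
    using assms by (simp only: lessThan_Suc image_insert) (simp add: last_conv_nth hd_conv_nth)
  also have "(\<lambda>k. {vs ! k, vs ! ((k + 1) mod ?n)}) ` {..<?n - 1}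
      = (\<lambda>k. {vs ! k, vs ! (k + 1)}) ` {..<?n - 1}"
    by (rule image_cong) auto
  also have "\<dots> = seg_edges vs"
    by (auto simp: seg_edges_def)
  finally show ?thesis by (simp add: cycle_edges_def)
qed

lemma is_cycle_iff:
  "is_cycle E C \<longleftrightarrow> (\<exists>vs. length vs \<ge> 3 \<and> distinct vs \<and> C = cycle_edges vs \<and> C \<subseteq> E)"
proof -
  have "length vs \<ge> 3 \<Longrightarrow>
      {{vs ! k, vs ! ((k + 1) mod length vs)} | k. k < length vs} = cycle_edges vs" for vs :: "'a list"
    by (rule cycle_edges_nth) auto
  then show ?thesis unfolding is_cycle_def by (simp only: cong: conj_cong)
qed

lemma Union_cycle_edges: "length vs \<ge> 2 \<Longrightarrow> \<Union>(cycle_edges vs) = set vs"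
  unfolding cycle_edges_def using Union_seg_edges[of vs] by (cases vs) auto

lemma cycle_edges_rotate: "cycle_edges (xs @ ys) = cycle_edges (ys @ xs)"
  by (cases "xs = []"; cases "ys = []")
    (auto simp: cycle_edges_def seg_edges_append)

text \<open>Rotation brings any chosen vertex to the front. Length at least 3 makes its two
  neighbours \<open>a\<close> and \<open>b\<close> on the cycle different.\<close>

lemma cycle_edges_start:
  assumes "length vs \<ge> 3" "distinct vs" "v \<in> set vs"
  obtains a zs b where "cycle_edges vs = cycle_edges (v # a # zs @ [b])"
    "distinct (v # a # zs @ [b])" "set vs = set (v # a # zs @ [b])"
    "length vs = length zs + 3"
proof -
  obtain xs ys where vs: "vs = xs @ v # ys"
    using assms(3) by (meson split_list)
  have "length (ys @ xs) \<ge> 2" using assms(1) vs by simp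
  then obtain a ws where "ys @ xs = a # ws" "ws \<noteq> []"
    by (cases "ys @ xs") (auto simp: Suc_le_eq)
  then obtain zs b where *: "ys @ xs = a # zs @ [b]" by (metis rev_exhaust)
  have "cycle_edges vs = cycle_edges (v # a # zs @ [b])"
    using cycle_edges_rotate[of xs "v # ys"] * vs by simp
  moreover have "distinct (v # ys @ xs)" "set vs = set (v # ys @ xs)"
    "length vs = Suc (length (ys @ xs))"
    using assms(2) vs by auto
  ultimately show ?thesis using that unfolding * by fastforce
qed

text \<open>The closing edge \<open>{b, v}\<close> is new: the only path edge at \<open>v\<close> is
  \<open>{v, a}\<close>, and \<open>a\<close> differs from \<open>b\<close>.\<close>

lemma card_cycle_edges:
  assumes "length vs \<ge> 3" "distinct vs"
  shows "card (cycle_edges vs) = length vs"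
proof -
  obtain v where "v \<in> set vs" using assms(1) by (cases vs) auto
  then obtain a zs b where *: "cycle_edges vs = cycle_edges (v # a # zs @ [b])"
    "distinct (v # a # zs @ [b])" "length vs = length zs + 3"
    using cycle_edges_start[OF assms] by metis
  have "{b, v} \<notin> seg_edges (a # zs @ [b])"
    using seg_edges_subset_set[of "{b, v}" "a # zs @ [b]"] *(2) by auto
  then have "{b, v} \<notin> seg_edges (v # a # zs @ [b])"
    using *(2) by (auto simp: doubleton_eq_iff)
  then have "card (cycle_edges (v # a # zs @ [b])) = Suc (card (seg_edges (v # a # zs @ [b])))"
    by (simp add: cycle_edges_def del: seg_edges_Cons)
  then show ?thesis using card_seg_edges[OF *(2)] * by simp
qed

lemma cycle_edges_card2: "length vs \<ge> 2 \<Longrightarrow> distinct vs \<Longrightarrow> e \<in> cycle_edges vs \<Longrightarrow> card e = 2"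
  using seg_edges_card2[of vs e]
  by (cases vs) (auto simp: cycle_edges_def card_insert_if split: if_splits)

section \<open>Counting independent sets\<close>

text \<open>Edges not contained in \<open>W\<close> forbid no subset of \<open>W\<close>. Hence
  vertices can be deleted by shrinking \<open>W\<close> alone, with the edge set left as it
  is.\<close>

lemma sigma_cong: "(\<And>e. e \<subseteq> W \<Longrightarrow> e \<in> F \<longleftrightarrow> e \<in> F') \<Longrightarrow> sigma W F = sigma W F'"
  unfolding sigma_def by (rule arg_cong[where f = card]) (auto; blast)

lemma sigma_empty [simp]: "{} \<notin> F \<Longrightarrow> sigma {} F = 1"
proof -
  assume "{} \<notin> F"
  then have "{S. S \<subseteq> {} \<and> (\<forall>e\<in>F. \<not> e \<subseteq> S)} = {{}}" by auto
  then show ?thesis by (simp add: sigma_def)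
qed

lemma sigma_mono: "finite W' \<Longrightarrow> W \<subseteq> W' \<Longrightarrow> sigma W F \<le> sigma W' F"
  unfolding sigma_def by (rule card_mono) auto

text \<open>The independent sets are split by whether they contain \<open>x\<close>. Those that do
  correspond, after removing \<open>x\<close>, to the independent subsets of \<open>W\<close> that
  avoid all neighbours of \<open>x\<close>.\<close>

lemma sigma_insert:
  assumes "finite W" "x \<notin> W" and two: "\<And>e. e \<in> F \<Longrightarrow> card e = 2"
  shows "sigma (insert x W) F = sigma W F + sigma (W - {y. {x, y} \<in> F}) F"
proof -
  let ?A = "{S. S \<subseteq> W \<and> (\<forall>e\<in>F. \<not> e \<subseteq> S)}"
  let ?B = "{S. S \<subseteq> W - {y. {x, y} \<in> F} \<and> (\<forall>e\<in>F. \<not> e \<subseteq> S)}"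
  have x: "e = {x, y}" if "e \<in> F" "x \<in> e" "y \<in> e" "y \<noteq> x" for e y
    using two[OF that(1)] that by (auto simp: card_2_iff)
  have y: "\<exists>y. y \<noteq> x \<and> y \<in> e" if "e \<in> F" for e
    using two[OF that] unfolding card_2_iff by (metis insertCI)
  have "{S. S \<subseteq> insert x W \<and> (\<forall>e\<in>F. \<not> e \<subseteq> S)} = ?A \<union> insert x ` ?B" (is "?L = ?R")
  proof
    show "?L \<subseteq> ?R"
    proof
      fix S assume S: "S \<in> ?L"
      show "S \<in> ?R"
      proof (cases "x \<in> S")
        case True
        have "S - {x} \<in> ?B" using S True by auto
        moreover have "S = insert x (S - {x})" using True by auto
        ultimately show ?thesis by blast
      qed (use S in auto)
    qed
    show "?R \<subseteq> ?L"
    proof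
      fix S assume "S \<in> ?R"
      then consider "S \<in> ?A" | T where "T \<in> ?B" "S = insert x T" by blast
      then show "S \<in> ?L"
      proof cases
        case 2
        have "\<not> e \<subseteq> S" if "e \<in> F" for e
        proof
          assume e: "e \<subseteq> S"
          obtain z where z: "z \<noteq> x" "z \<in> e" using y[OF \<open>e \<in> F\<close>] by blast
          show False
          proof (cases "x \<in> e")
            case True
            then have "e = {x, z}" using x \<open>e \<in> F\<close> z by blast
            then show False using z e 2 \<open>e \<in> F\<close> by auto
          next
            case False
            then show False using e 2 \<open>e \<in> F\<close> by blast
          qed
        qed
        then show ?thesis using 2 by auto
      qed auto
    qed
  qed
  moreover have "?A \<inter> insert x ` ?B = {}" using assms(2) by auto
  moreover have "finite ?A" "finite ?B" using assms(1) by auto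
  moreover have "inj_on (insert x) ?B"
    by (rule inj_onI) (use assms(2) in \<open>metis (no_types, lifting) Diff_subset insert_ident mem_Collect_eq subset_iff\<close>)
  ultimately show ?thesis
    by (simp add: sigma_def card_Un_disjoint card_image)
qed

text \<open>Splitting at the free end of the path yields the Fibonacci recursion in its length,
  which reaches back two steps; hence the strong induction. The vertex \<open>u\<close> may also lie
  outside \<open>W\<close>: then \<open>W - {u} = W\<close>, and the path contributes the factor
  \<open>fib (length xs + 2)\<close>.\<close>

lemma sigma_attach_path:
  assumes "finite W" "\<And>e. e \<in> F \<Longrightarrow> card e = 2" "distinct (u # xs)"
    and "set xs \<inter> W = {}" "set xs \<inter> \<Union>F = {}"
  shows "sigma (W \<union> set xs) (F \<union> seg_edges (u # xs)) =
    fib (length xs + 1) * sigma W F + fib (length xs) * sigma (W - {u}) F"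
  using assms(3-5)
proof (induction "length xs" arbitrary: xs rule: less_induct)
  case less
  show ?case
  proof (cases xs rule: rev_cases)
    case (snoc ys x)
    let ?F = "F \<union> seg_edges (u # xs)"
    let ?l = "last (u # ys)"
    have F: "?F = insert {?l, x} (F \<union> seg_edges (u # ys))"
      using seg_edges_snoc[of "u # ys" x] snoc by auto
    have ux: "x \<noteq> u" "x \<notin> set ys" "x \<notin> W" "x \<notin> \<Union>F"
      using less.prems snoc by auto
    then have lx: "?l \<noteq> x" by (auto split: if_splits)
    have xs: "x \<notin> e" if "e \<in> F \<union> seg_edges (u # ys)" for e
      using that ux seg_edges_subset_set[of e "u # ys"] by auto
    have "card e = 2" if "e \<in> ?F" for e
      using that assms(2) seg_edges_card2[OF less.prems(1)] by auto
    moreover have "{y. {x, y} \<in> ?F} = {?l}"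
    proof -
      have "{x, y} \<in> ?F \<longleftrightarrow> {x, y} = {?l, x}" for y
        unfolding F using xs by blast
      then show ?thesis using lx by (auto simp: doubleton_eq_iff)
    qed
    ultimately have "sigma (insert x (W \<union> set ys)) ?F
        = sigma (W \<union> set ys) ?F + sigma (W \<union> set ys - {?l}) ?F"
      using sigma_insert[of "W \<union> set ys" x ?F] assms(1) ux by auto
    moreover have "sigma (W \<union> set ys) ?F = sigma (W \<union> set ys) (F \<union> seg_edges (u # ys))"
      by (rule sigma_cong) (use F ux in auto)
    moreover have "\<dots> = fib (length ys + 1) * sigma W F + fib (length ys) * sigma (W - {u}) F"
      by (rule less.hyps) (use less.prems snoc in auto)
    \<comment> \<open>For empty \<open>ys\<close> the neighbour of \<open>x\<close> is
      \<open>u\<close> itself, so that only \<open>sigma (W - {u}) F\<close> remains. The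
      coefficient 1 is the Fibonacci number of index -1.\<close>
    moreover have "sigma (W \<union> set ys - {?l}) ?F
        = fib (length ys) * sigma W F + (if ys = [] then 1 else fib (length ys - 1)) * sigma (W - {u}) F"
    proof (cases ys rule: rev_cases)
      case Nil
      have "sigma (W - {u}) ?F = sigma (W - {u}) F"
        by (rule sigma_cong) (use F ux Nil in auto)
      then show ?thesis using Nil by simp
    next
      case (snoc zs y)
      have y: "y \<notin> W" "y \<notin> \<Union>F" "y \<notin> set zs" "y \<noteq> u"
        using less.prems snoc \<open>xs = ys @ [x]\<close> by auto
      have S: "W \<union> set ys - {?l} = W \<union> set zs" using y snoc by auto
      have F': "?F = insert {last (u # ys), x} (insert {last (u # zs), y} (F \<union> seg_edges (u # zs)))"
        using F seg_edges_snoc[of "u # zs" y] snoc by auto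
      have "sigma (W \<union> set zs) ?F = sigma (W \<union> set zs) (F \<union> seg_edges (u # zs))"
        by (rule sigma_cong) (use F' ux y snoc in auto)
      also have "\<dots> = fib (length zs + 1) * sigma W F + fib (length zs) * sigma (W - {u}) F"
        by (rule less.hyps) (use less.prems snoc \<open>xs = ys @ [x]\<close> in auto)
      finally show ?thesis using S snoc by simp
    qed
    ultimately show ?thesis using snoc
      by (cases ys rule: rev_cases) (auto simp: algebra_simps insert_commute)
  qed (use assms in simp)
qed

text \<open>The case of an empty \<open>W\<close>: \<open>u\<close> only carries the first edge and
  is not among the vertices counted.\<close>

lemma sigma_path:
  assumes "distinct (u # xs)"
  shows "sigma (set xs) (seg_edges (u # xs)) = fib (length xs + 2)"
  using sigma_attach_path[of "{}" "{}" u xs] assms by simp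

text \<open>Deleting \<open>v\<close> from a cycle on \<open>n\<close> vertices leaves a path on
  \<open>n - 1\<close> vertices; deleting its two neighbours as well leaves a path on
  \<open>n - 3\<close> vertices.\<close>

lemma sigma_cycle:
  assumes "length vs \<ge> 3" "distinct vs" "v \<in> set vs"
  shows sigma_cycle_minus: "sigma (set vs - {v}) (cycle_edges vs) = fib (length vs + 1)"
    and sigma_cycle_eq: "sigma (set vs) (cycle_edges vs) = fib (length vs + 1) + fib (length vs - 1)"
proof -
  obtain a zs b where *: "cycle_edges vs = cycle_edges (v # a # zs @ [b])"
    "distinct (v # a # zs @ [b])" "set vs = set (v # a # zs @ [b])"
    "length vs = length zs + 3"
    by (rule cycle_edges_start[OF assms])
  let ?ws = "a # zs @ [b]" and ?C = "cycle_edges vs"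
  have C: "?C = insert {b, v} (insert {v, a} (seg_edges ?ws))"
    using *(1) by (simp add: cycle_edges_def)
  have vC: "v \<notin> e" if "e \<in> seg_edges ?ws" for e
    using seg_edges_subset_set[OF that] *(2) by auto
  have ws: "set vs - {v} = set ?ws" using *(2,3) by auto
  have "sigma (set ?ws) ?C = sigma (set ?ws) (seg_edges (v # ?ws))"
    by (rule sigma_cong) (use C *(2) in auto)
  also have "\<dots> = fib (length vs + 1)"
    using sigma_path[OF *(2)] *(4) by (simp add: numeral_3_eq_3)
  finally have 1: "sigma (set ?ws) ?C = fib (length vs + 1)" .
  then show "sigma (set vs - {v}) ?C = fib (length vs + 1)" using ws by simp
  have nb: "{y. {v, y} \<in> ?C} = {a, b}"
    unfolding C using vC *(2) by (auto simp: doubleton_eq_iff)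
  have zs: "set ?ws - {a, b} = set zs" using *(2) by auto
  have C': "?C = insert {b, v} (insert {v, a} (insert {last (a # zs), b} (seg_edges (a # zs))))"
    using C seg_edges_snoc[of "a # zs" b] by simp
  have "sigma (set zs) ?C = sigma (set zs) (seg_edges (a # zs))"
    by (rule sigma_cong) (use C' *(2) in auto)
  also have "\<dots> = fib (length vs - 1)"
    using sigma_path[of a zs] *(2,4) by (simp add: numeral_eq_Suc)
  finally have 2: "sigma (set zs) ?C = fib (length vs - 1)" .
  have "v \<notin> set ?ws" using *(2) by simp
  moreover have "card e = 2" if "e \<in> ?C" for e
    using cycle_edges_card2[of vs e] that assms by simp
  ultimately have sum: "sigma (insert v (set ?ws)) ?C
      = sigma (set ?ws) ?C + sigma (set ?ws - {y. {v, y} \<in> ?C}) ?C"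
    by (intro sigma_insert) simp_all
  have "insert v (set ?ws) = set vs" using *(3) by simp
  from sum[unfolded this nb zs 1 2]
  show "sigma (set vs) ?C = fib (length vs + 1) + fib (length vs - 1)" .
qed

section \<open>Segments of a graph\<close>

lemma degree_two_edges:
  assumes "degree E v = 2" "e1 \<in> E" "e2 \<in> E" "v \<in> e1" "v \<in> e2" "e1 \<noteq> e2" "e \<in> E" "v \<in> e"
  shows "e = e1 \<or> e = e2"
proof -
  have "finite {e\<in>E. v \<in> e}" using assms(1) by (intro card_ge_0_finite) (simp add: degree_def)
  moreover have "{e1, e2} \<subseteq> {e\<in>E. v \<in> e}" using assms by auto
  moreover have "card {e1, e2} = card {e\<in>E. v \<in> e}" using assms by (simp add: degree_def)
  ultimately have "{e1, e2} = {e\<in>E. v \<in> e}" by (rule card_subset_eq)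
  then show ?thesis using assms by blast
qed

text \<open>Both the cycle and each segment are closed in the following sense, so a segment is contained in
  such a set as soon as it meets it.\<close>
definition deg2_closed :: "'a set set \<Rightarrow> 'a set set \<Rightarrow> bool" where
  "deg2_closed E F \<longleftrightarrow>
    (\<forall>v e e'. degree E v = 2 \<longrightarrow> e \<in> F \<longrightarrow> v \<in> e \<longrightarrow> e' \<in> E \<longrightarrow> v \<in> e' \<longrightarrow> e' \<in> F)"

lemma deg2_closedD:
  "deg2_closed E F \<Longrightarrow> degree E v = 2 \<Longrightarrow> e \<in> F \<Longrightarrow> v \<in> e \<Longrightarrow> e' \<in> E \<Longrightarrow> v \<in> e' \<Longrightarrow> e' \<in> F"
  unfolding deg2_closed_def by blast

lemma deg2_closed_Union: "(\<And>F. F \<in> T \<Longrightarrow> deg2_closed E F) \<Longrightarrow> deg2_closed E (\<Union>T)"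
  unfolding deg2_closed_def by blast

lemma seg_edges_subset: "is_segment E p \<Longrightarrow> seg_edges p \<subseteq> E"
  unfolding is_segment_def seg_edges_def by auto

lemma segment_endpoints:
  assumes "is_segment E p" "v \<in> set p" "degree E v \<noteq> 2"
  shows "v = hd p \<or> v = last p"
proof -
  obtain k where k: "k < length p" "v = p ! k" using assms(2) by (metis in_set_conv_nth)
  have "\<not> (0 < k \<and> k + 1 < length p)"
    using assms k unfolding is_segment_def by blast
  then have "k = 0 \<or> k = length p - 1" using k by linarith
  then show ?thesis using k assms(2) by (metis hd_conv_nth last_conv_nth list.size(3) not_less0)
qed

text \<open>A vertex of degree 2 on a segment is not an end, so it has two edges on the segment, and
  these are all its edges.\<close>

lemma segment_deg2_closed:
  assumes "is_segment E p"
  shows "deg2_closed E (seg_edges p)"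
  unfolding deg2_closed_def
proof (intro allI impI)
  fix v e e'
  assume v: "degree E v = 2" "e \<in> seg_edges p" "v \<in> e" "e' \<in> E" "v \<in> e'"
  from assms have len: "length p \<ge> 2" and d: "distinct (butlast p)" "distinct (tl p)"
    and hl: "hd p = last p \<longrightarrow> length p \<ge> 4"
    and deg: "degree E (hd p) = 1 \<or> degree E (hd p) \<ge> 3"
      "degree E (last p) = 1 \<or> degree E (last p) \<ge> 3"
    unfolding is_segment_def by auto
  have "v \<in> set p" using v seg_edges_subset_set by fastforce
  then obtain k where k: "k < length p" "v = p ! k" by (metis in_set_conv_nth)
  have "p \<noteq> []" using len by auto
  have "k \<noteq> 0"
  proof
    assume "k = 0"
    then show False using deg(1) v(1) k(2) hd_conv_nth[OF \<open>p \<noteq> []\<close>] by simp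
  qed
  moreover have "k \<noteq> length p - 1" using deg(2) v(1) k(2) last_conv_nth[OF \<open>p \<noteq> []\<close>] by auto
  ultimately have k1: "0 < k" "k + 1 < length p" using k(1) by linarith+
  define j where "j = k - 1"
  have kj: "k = Suc j" using k1 by (simp add: j_def)
  \<comment> \<open>The neighbours of \<open>p ! k\<close> on the segment differ. Distinctness is
    only known for \<open>butlast p\<close> and \<open>tl p\<close>, since the ends may coincide; if
    the two neighbours are both ends, then \<open>length p = 3\<close>, where coinciding ends are
    excluded.\<close>
  have "p ! j \<noteq> p ! (k + 1)"
  proof (cases "j = 0")
    case True
    show ?thesis
    proof (cases "k + 1 = length p - 1")
      case True
      then have "length p = 3" using \<open>j = 0\<close> kj k1 by simp
      then have "hd p \<noteq> last p" using hl by auto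
      then show ?thesis using True \<open>j = 0\<close> hd_conv_nth[OF \<open>p \<noteq> []\<close>] last_conv_nth[OF \<open>p \<noteq> []\<close>] by simp
    next
      case False
      then have "butlast p ! j \<noteq> butlast p ! (k + 1)"
        using d(1) k1 kj by (subst nth_eq_iff_index_eq) auto
      then show ?thesis using False k1 kj by (simp add: nth_butlast)
    qed
  next
    case False
    then have "tl p ! (j - 1) \<noteq> tl p ! k"
      using d(2) k1 kj by (subst nth_eq_iff_index_eq) auto
    then show ?thesis using False k1 kj by (simp add: nth_tl)
  qed
  then have "{p ! j, p ! (j + 1)} \<noteq> {p ! k, p ! (k + 1)}" by (auto simp: doubleton_eq_iff kj)
  moreover have "{p ! j, p ! (j + 1)} \<in> seg_edges p" "{p ! k, p ! (k + 1)} \<in> seg_edges p"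
    using k1 kj unfolding seg_edges_def by auto
  moreover have "v \<in> {p ! j, p ! (j + 1)}" "v \<in> {p ! k, p ! (k + 1)}" using k(2) kj by auto
  ultimately show "e' \<in> seg_edges p"
    using degree_two_edges[OF v(1), of "{p ! j, p ! (j + 1)}" "{p ! k, p ! (k + 1)}" e'] v(4,5)
      seg_edges_subset[OF assms] by blast
qed

text \<open>Consecutive edges of a segment share a vertex of degree 2, so membership in
  \<open>F\<close> passes along the segment in both directions.\<close>

lemma segment_subset_closed:
  assumes "is_segment E p" "deg2_closed E F" "seg_edges p \<inter> F \<noteq> {}"
  shows "seg_edges p \<subseteq> F"
proof -
  let ?e = "\<lambda>k. {p ! k, p ! (k + 1)}"
  have eE: "?e k \<in> E" if "k + 1 < length p" for k
    using assms(1) that unfolding is_segment_def by blast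
  have deg: "degree E (p ! (k + 1)) = 2" if "k + 2 < length p" for k
    using assms(1) that unfolding is_segment_def by auto
  have step: "?e k \<in> F \<longleftrightarrow> ?e (k + 1) \<in> F" if "k + 2 < length p" for k
    using deg2_closedD[OF assms(2) deg[OF that], of "?e k" "?e (k + 1)"]
      deg2_closedD[OF assms(2) deg[OF that], of "?e (k + 1)" "?e k"]
      eE[of k] eE[of "k + 1"] that by auto
  have all: "?e k \<in> F \<longleftrightarrow> ?e 0 \<in> F" if "k + 1 < length p" for k
    using that
  proof (induction k)
    case (Suc k)
    then show ?case using step[of k] by simp
  qed simp
  then show ?thesis using assms(3) unfolding seg_edges_def by auto
qed

text \<open>Each of two segments with a common edge is closed, so each contains the other.\<close>

lemma segments_disjoint:
  assumes "s \<in> segments E" "t \<in> segments E" "s \<noteq> t"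
  shows "s \<inter> t = {}"
proof -
  obtain p q where "is_segment E p" "s = seg_edges p" "is_segment E q" "t = seg_edges q"
    using assms unfolding segments_def by blast
  then show ?thesis
    using assms(3) segment_subset_closed[of E p "seg_edges q"] segment_subset_closed[of E q "seg_edges p"]
      segment_deg2_closed by blast
qed

lemma segments_deg2_closed: "s \<in> segments E \<Longrightarrow> deg2_closed E s"
  unfolding segments_def using segment_deg2_closed by blast

lemma segments_nonempty: "s \<in> segments E \<Longrightarrow> s \<noteq> {}"
proof -
  assume "s \<in> segments E"
  then obtain p where "is_segment E p" "s = seg_edges p" unfolding segments_def by blast
  moreover have "0 + 1 < length p" using calculation(1) unfolding is_segment_def by simp
  ultimately have "{p ! 0, p ! (0 + 1)} \<in> s" unfolding seg_edges_def by blast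
  then show "s \<noteq> {}" by blast
qed

lemma segments_subset: "s \<in> segments E \<Longrightarrow> s \<subseteq> E"
  unfolding segments_def using seg_edges_subset by blast

section \<open>Edges, degrees and segments in simple graphs\<close>

lemma simple_graph_subset:
  assumes "simple_graph V E" "e \<in> E"
  shows "e \<subseteq> V"
proof -
  obtain a b where "e = {a, b}" "a \<in> V" "b \<in> V" using assms unfolding simple_graph_def by blast
  then show ?thesis by simp
qed

lemma simple_graph_finite_edges:
  assumes "simple_graph V E"
  shows "finite E"
proof (rule finite_subset)
  show "E \<subseteq> Pow V" using simple_graph_subset[OF assms] by blast
  show "finite (Pow V)" using assms by (simp add: simple_graph_def)
qed

lemma simple_graph_edge: 
  assumes "simple_graph V E" "{u, v} \<in> E"
  shows "u \<in> V" "v \<in> V" "u \<noteq> v"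
proof -
  obtain a b where "{u, v} = {a, b}" "a \<noteq> b" "a \<in> V" "b \<in> V"
    using assms unfolding simple_graph_def by blast
  then show "u \<in> V" "v \<in> V" "u \<noteq> v" by (auto simp: doubleton_eq_iff)
qed

lemma simple_graph_incident:
  assumes "simple_graph V E" "e \<in> E" "v \<in> e"
  obtains w where "e = {v, w}"
proof -
  obtain a b where "e = {a, b}" using assms(1,2) unfolding simple_graph_def by blast
  then have "e = {v, b} \<or> e = {v, a}" using assms(3) by auto
  then show ?thesis using that by blast
qed

lemma degree_pos:
  assumes "simple_graph V E" "e \<in> E" "v \<in> e"
  shows "degree E v > 0"
proof -
  have "finite {e\<in>E. v \<in> e}" using simple_graph_finite_edges[OF assms(1)] by simp
  moreover have "{e\<in>E. v \<in> e} \<noteq> {}" using assms by blast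
  ultimately show ?thesis unfolding degree_def by (simp add: card_gt_0_iff)
qed

text \<open>Every edge at a vertex of degree other than 2 begins a segment. A longest path from
  \<open>u\<close> through \<open>w\<close> with inner degrees 2 either ends at a vertex of degree
  other than 2, or its only possible continuation leads back to \<open>u\<close>.\<close>

lemma segment_from:
  assumes sg: "simple_graph V E" and u: "degree E u \<noteq> 2" and uw: "{u, w} \<in> E"
  obtains p where "is_segment E p" "hd p = u" "p ! 1 = w"
proof -
  define A where "A = {p. length p \<ge> 2 \<and> distinct p \<and> hd p = u \<and> p ! 1 = w \<and> seg_edges p \<subseteq> E \<and>
    (\<forall>k. 0 < k \<and> k + 1 < length p \<longrightarrow> degree E (p ! k) = 2)}"
  have uw': "u \<noteq> w" using simple_graph_edge[OF sg uw] by auto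
  have "[u, w] \<in> A" using uw uw' by (auto simp: A_def)
  moreover have "\<forall>p. p \<in> A \<longrightarrow> length p < Suc (card V)"
  proof (intro allI impI)
    fix p assume "p \<in> A"
    then have "length p \<ge> 2" "distinct p" "seg_edges p \<subseteq> E" by (auto simp: A_def)
    then have "set p \<subseteq> V" using Union_seg_edges[of p] simple_graph_subset[OF sg] by blast
    then have "card (set p) \<le> card V" using sg by (intro card_mono) (auto simp: simple_graph_def)
    then show "length p < Suc (card V)" using \<open>distinct p\<close> by (simp add: distinct_card)
  qed
  ultimately obtain p where pA: "p \<in> A" and max: "\<And>q. q \<in> A \<Longrightarrow> length q \<le> length p"
    using ex_has_greatest_nat[of "\<lambda>p. p \<in> A" "[u, w]" length "Suc (card V)"] by blast
  then have p: "length p \<ge> 2" "distinct p" "hd p = u" "p ! 1 = w" "seg_edges p \<subseteq> E"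
    and deg: "\<And>k. 0 < k \<and> k + 1 < length p \<Longrightarrow> degree E (p ! k) = 2"
    by (auto simp: A_def)
  have edges: "{p ! k, p ! (k + 1)} \<in> E" if "k + 1 < length p" for k
    using p(5) that unfolding seg_edges_def by blast
  have "p \<noteq> []" using p(1) by auto
  have p0: "p ! 0 = u" using p(3) \<open>p \<noteq> []\<close> by (simp add: hd_conv_nth)
  define n where "n = length p - 2"
  have n: "length p = n + 2" using p(1) by (simp add: n_def)
  define z where "z = last p"
  have z: "z = p ! (n + 1)" using n \<open>p \<noteq> []\<close> by (simp add: z_def last_conv_nth)
  have yz: "{p ! n, z} \<in> E" using edges[of n] n z by simp
  have udeg: "degree E u = 1 \<or> degree E u \<ge> 3"
    using degree_pos[OF sg uw, of u] u by auto
  have nth_inj: "p ! i = p ! j \<longleftrightarrow> i = j" if "i < length p" "j < length p" for i j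
    using that p(2) by (simp add: nth_eq_iff_index_eq)
  show ?thesis
  proof (cases "degree E z = 2")
    case False
    then have "degree E z = 1 \<or> degree E z \<ge> 3"
      using degree_pos[OF sg yz, of z] by auto
    moreover have "hd p \<noteq> last p"
      using nth_inj[of 0 "n + 1"] n p0 p(3) z z_def by auto
    ultimately have "is_segment E p"
      unfolding is_segment_def
      using p edges deg udeg by (simp add: distinct_butlast distinct_tl z_def)
    then show ?thesis using that p by blast
  next
    case True
    have "\<exists>e\<in>E. z \<in> e \<and> e \<noteq> {p ! n, z}"
    proof (rule ccontr)
      assume "\<not> ?thesis"
      then have "{e\<in>E. z \<in> e} \<subseteq> {{p ! n, z}}" by blast
      then have "card {e\<in>E. z \<in> e} \<le> card {{p ! n, z}}" by (intro card_mono) auto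
      then show False using True by (simp add: degree_def)
    qed
    then obtain y where y: "{z, y} \<in> E" "{z, y} \<noteq> {p ! n, z}"
      using simple_graph_incident[OF sg] by metis
    then have yn: "y \<noteq> p ! n" "y \<noteq> z" using simple_graph_edge[OF sg y(1)] by auto
    have edges_q: "seg_edges (p @ [y]) \<subseteq> E"
      using p(5) y(1) \<open>p \<noteq> []\<close> by (simp add: z_def)
    have deg_q: "degree E ((p @ [y]) ! k) = 2" if "0 < k" "k + 1 < length (p @ [y])" for k
    proof (cases "k + 1 < length p")
      case False
      then have "k = n + 1" using that n by simp
      then show ?thesis using True z n by (simp add: nth_append)
    qed (use deg that in \<open>simp add: nth_append\<close>)
    \<comment> \<open>Otherwise the path could be prolonged by \<open>y\<close>, against
      maximality.\<close>
    have "y \<in> set p"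
    proof (rule ccontr)
      assume "y \<notin> set p"
      have "p @ [y] \<in> A"
        unfolding A_def mem_Collect_eq
      proof (intro conjI allI impI)
        show "hd (p @ [y]) = u" "(p @ [y]) ! 1 = w" "distinct (p @ [y])"
          using p \<open>p \<noteq> []\<close> \<open>y \<notin> set p\<close> by (auto simp: nth_append)
      qed (use p(1) edges_q deg_q in auto)
      then show False using max[of "p @ [y]"] by simp
    qed
    then obtain k where k: "k < length p" "y = p ! k" by (metis in_set_conv_nth)
    have "k = 0"
    proof (rule ccontr)
      assume "k \<noteq> 0"
      have kn: "k < n"
        using k yn n z by (metis Suc_eq_plus1 add_2_eq_Suc' less_SucE)
      define j where "j = k - 1"
      have kj: "k = j + 1" using \<open>k \<noteq> 0\<close> by (simp add: j_def)
      \<comment> \<open>The inner vertex \<open>p ! k\<close> has both its edges on the path, so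
        \<open>{z, y}\<close> would be one of them. As \<open>k < n\<close>, neither reaches the end
        \<open>z\<close> of the path.\<close>
      have "{p ! j, p ! (j + 1)} \<noteq> {p ! k, p ! (k + 1)}"
        using kn kj n nth_inj[of j "k + 1"] by (auto simp: doubleton_eq_iff)
      then have "{z, y} = {p ! j, p ! (j + 1)} \<or> {z, y} = {p ! k, p ! (k + 1)}"
        using degree_two_edges[of E y "{p ! j, p ! (j + 1)}" "{p ! k, p ! (k + 1)}" "{z, y}"]
          deg[of k] k edges[of j] edges[of k] y(1) kj kn n by auto
      then have "z = p ! j \<or> z = p ! (k + 1)"
        using yn kj k by (auto simp: doubleton_eq_iff)
      then show False using z nth_inj[of j "n + 1"] nth_inj[of "k + 1" "n + 1"] kj kn n by auto
    qed
    then have yu: "y = u" using k p0 by simp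
    have "n \<noteq> 0" using yn yu p0 by (metis)
    have tl: "tl (p @ [y]) = tl p @ [u]" using \<open>p \<noteq> []\<close> yu by simp
    have "u \<notin> set (tl p)" using p(2,3) \<open>p \<noteq> []\<close> by (cases p) auto
    then have dt: "distinct (tl (p @ [y]))" using tl p(2) by (simp add: distinct_tl)
    \<comment> \<open>the walk returns to its start: the segment is a cycle hanging at \<open>u\<close>\<close>
    have "is_segment E (p @ [y])"
      unfolding is_segment_def
    proof (intro conjI allI impI)
      show "{(p @ [y]) ! k, (p @ [y]) ! (k + 1)} \<in> E" if "k + 1 < length (p @ [y])" for k
        using edges_q that unfolding seg_edges_def by blast
      show "4 \<le> length (p @ [y])" using n \<open>n \<noteq> 0\<close> by simp
      show "degree E (hd (p @ [y])) = 1 \<or> 3 \<le> degree E (hd (p @ [y]))"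
        using udeg p(3) \<open>p \<noteq> []\<close> by simp
    qed (use p(1,2) dt udeg yu deg_q in auto)
    moreover have "hd (p @ [y]) = u" "(p @ [y]) ! 1 = w"
      using p \<open>p \<noteq> []\<close> by (auto simp: nth_append)
    ultimately show ?thesis using that by blast
  qed
qed

section \<open>Walks, paths and connectedness\<close>

text \<open>A walk is extended vertex by vertex; when a vertex recurs, the path is cut back to its
  earlier occurrence.\<close>

lemma rtranclp_adj_path:
  assumes "(adj F)\<^sup>*\<^sup>* a b"
  obtains q where "q \<noteq> []" "hd q = a" "last q = b" "distinct q" "seg_edges q \<subseteq> F"
  using assms
proof (induction arbitrary: thesis rule: rtranclp_induct)
  case base
  show ?case by (rule base[of "[a]"]) auto
next
  case (step b c)
  obtain q where q: "q \<noteq> []" "hd q = a" "last q = b" "distinct q" "seg_edges q \<subseteq> F"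
    using step.IH by blast
  show ?case
  proof (cases "c \<in> set q")
    case True
    then obtain q1 q2 where q12: "q = (q1 @ [c]) @ q2" by (metis split_list append.assoc append_Cons append_Nil)
    have "seg_edges (q1 @ [c]) \<subseteq> seg_edges q"
    proof (cases "q2 = []")
      case False
      then show ?thesis unfolding q12 by (subst (2) seg_edges_append) auto
    qed (simp add: q12)
    then show ?thesis
      by (intro step.prems[of "q1 @ [c]"]) (use q q12 in \<open>auto simp: hd_append\<close>)
  next
    case False
    then show ?thesis
      by (intro step.prems[of "q @ [c]"]) (use q step.hyps(2) in \<open>auto simp: adj_def\<close>)
  qed
qed

lemma simple_graph_vertex:
  assumes "simple_graph V E" "e \<in> E"
  obtains v where "v \<in> e" "v \<in> V"
proof -
  obtain a b where "e = {a, b}" "a \<in> V" using assms unfolding simple_graph_def by blast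
  then show ?thesis using that[of a] by simp
qed

lemma butlast_hd: "length p \<ge> 2 \<Longrightarrow> butlast p \<noteq> [] \<and> hd (butlast p) = hd p"
  by (cases p; cases "tl p") auto

lemma adj_mono: "F \<subseteq> F' \<Longrightarrow> (adj F)\<^sup>*\<^sup>* a b \<Longrightarrow> (adj F')\<^sup>*\<^sup>* a b"
  by (rule rtranclp_mono[THEN predicate2D]) (auto simp: adj_def)

lemma adj_rtranclp_sym: "(adj F)\<^sup>*\<^sup>* a b \<Longrightarrow> (adj F)\<^sup>*\<^sup>* b a"
  by (rule symp_rtranclp[THEN sympD]) (auto simp: adj_def symp_def insert_commute)

lemma adj_path: "v \<in> set p \<Longrightarrow> (adj (seg_edges p))\<^sup>*\<^sup>* (hd p) v"
proof (induction p rule: induct_list012)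
  case (3 x y zs)
  show ?case
  proof (cases "v = x")
    case False
    then have "(adj (seg_edges (y # zs)))\<^sup>*\<^sup>* y v" using "3.IH"(2) "3.prems" by simp
    then have "(adj (seg_edges (x # y # zs)))\<^sup>*\<^sup>* y v"
      by (rule adj_mono[rotated]) (simp add: subset_insertI)
    moreover have "adj (seg_edges (x # y # zs)) x y" by (simp add: adj_def)
    ultimately show ?thesis
      unfolding list.sel by (metis converse_rtranclp_into_rtranclp)
  qed simp
qed simp_all

lemma adj_connected_Un:
  assumes "\<And>a b. a \<in> W \<Longrightarrow> b \<in> W \<Longrightarrow> (adj F)\<^sup>*\<^sup>* a b" "hd p \<in> W"
    and "a \<in> W \<union> set p" "b \<in> W \<union> set p"
  shows "(adj (F \<union> seg_edges p))\<^sup>*\<^sup>* a b"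
proof -
  have to_hd: "(adj (F \<union> seg_edges p))\<^sup>*\<^sup>* (hd p) c" if "c \<in> W \<union> set p" for c
    using that
  proof
    assume "c \<in> W"
    from adj_mono[OF _ assms(1)[OF assms(2) this]] show ?thesis by simp
  next
    assume "c \<in> set p"
    from adj_mono[OF _ adj_path[OF this]] show ?thesis by simp
  qed
  show ?thesis
    using adj_rtranclp_sym[OF to_hd[OF assms(3)]] to_hd[OF assms(4)] by (rule rtranclp_trans)
qed

section \<open>Growing a unicyclic graph from its cycle\<close>

text \<open>The assumption \<open>branch\<close> rules out a graph that is only a cycle: there all
  degrees are 2 and no segment exists.\<close>

locale unicyclic_graph =
  fixes V :: "'a set" and E C :: "'a set set"
  assumes simple: "simple_graph V E"
    and connected: "connected_graph V E"
    and cycle: "is_cycle E C"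
    and cycle_unique: "is_cycle E D \<Longrightarrow> D = C"
    and branch: "\<exists>b\<in>V. degree E b \<noteq> 2"
begin

lemma finite_segments: "finite (segments E)"
  by (rule finite_subset[of _ "Pow E"])
    (use segments_subset simple_graph_finite_edges[OF simple] in auto)

lemma cycle_subset: "C \<subseteq> E"
  using cycle unfolding is_cycle_iff by blast

lemma cycle_nonempty: "C \<noteq> {}"
  using cycle unfolding is_cycle_iff cycle_edges_def by auto

text \<open>Each vertex of the cycle has two edges on it; if its degree is 2, there are no
  others.\<close>

lemma cycle_deg2_closed: "deg2_closed E C"
  unfolding deg2_closed_def
proof (intro allI impI)
  fix v e e'
  assume v: "degree E v = 2" "e \<in> C" "v \<in> e" "e' \<in> E" "v \<in> e'"
  obtain vs where vs: "length vs \<ge> 3" "distinct vs" "C = cycle_edges vs"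
    using cycle unfolding is_cycle_iff by blast
  have "v \<in> \<Union>(cycle_edges vs)" using v(2,3) vs(3) by blast
  then have "v \<in> set vs" using vs(1) by (simp add: Union_cycle_edges)
  then obtain a zs b where *: "cycle_edges vs = cycle_edges (v # a # zs @ [b])"
    "distinct (v # a # zs @ [b])" "set vs = set (v # a # zs @ [b])" "length vs = length zs + 3"
    by (rule cycle_edges_start[OF vs(1,2)])
  have C: "{v, a} \<in> C" "{b, v} \<in> C"
    unfolding vs(3) *(1) by (simp_all add: cycle_edges_def)
  have "{v, a} \<noteq> {b, v}" using *(2) by (simp add: doubleton_eq_iff)
  moreover have "{v, a} \<in> E" "{b, v} \<in> E" using C cycle_subset by blast+
  ultimately have "e' = {v, a} \<or> e' = {b, v}"
    using v(4,5) by (intro degree_two_edges[OF v(1)]) simp_all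
  then show "e' \<in> C" using C by (elim disjE) simp_all
qed

lemma edge_in_segment_at_branch:
  assumes "degree E v \<noteq> 2" "e \<in> E" "v \<in> e"
  shows "e \<in> \<Union>(segments E)"
proof -
  obtain w where w: "e = {v, w}" using simple_graph_incident[OF simple assms(2,3)] .
  then obtain p where p: "is_segment E p" "hd p = v" "p ! 1 = w"
    using segment_from[OF simple assms(1)] assms(2) by metis
  have "length p \<ge> 2" using p(1) by (simp add: is_segment_def)
  then have "{p ! 0, p ! (0 + 1)} \<in> seg_edges p" unfolding seg_edges_def by fastforce
  moreover have "p ! 0 = v" using p(2) \<open>length p \<ge> 2\<close> by (cases p) auto
  ultimately have "e \<in> seg_edges p" using p(3) w by simp
  then show ?thesis using p(1) unfolding segments_def by blast
qed

text \<open>Starting from a branch vertex or leaf \<open>b\<close>, the property that all edges at a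
  vertex are covered spreads along walks: at degree 2 by closedness, elsewhere because every edge
  begins a segment.\<close>

lemma Union_segments: "\<Union>(segments E) = E"
proof
  show "\<Union>(segments E) \<subseteq> E" using segments_subset by blast
  have closed: "deg2_closed E (\<Union>(segments E))"
    by (rule deg2_closed_Union) (rule segments_deg2_closed)
  obtain b where b: "b \<in> V" "degree E b \<noteq> 2" using branch by blast
  have *: "\<forall>e\<in>E. v \<in> e \<longrightarrow> e \<in> \<Union>(segments E)" if "(adj E)\<^sup>*\<^sup>* b v" for v
    using that
  proof (induction rule: rtranclp_induct)
    case base
    then show ?case using edge_in_segment_at_branch b by blast
  next
    case (step v w)
    have vw: "{v, w} \<in> \<Union>(segments E)" using step by (auto simp: adj_def)
    show ?case
    proof (cases "degree E w = 2")
      case True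
      then show ?thesis using deg2_closedD[OF closed True vw] by blast
    qed (use edge_in_segment_at_branch in blast)
  qed
  show "E \<subseteq> \<Union>(segments E)"
  proof
    fix e assume "e \<in> E"
    moreover obtain v where "v \<in> e" "v \<in> V"
      using simple_graph_vertex[OF simple \<open>e \<in> E\<close>] .
    moreover have "(adj E)\<^sup>*\<^sup>* b v" using connected b \<open>v \<in> V\<close> unfolding connected_graph_def by blast
    ultimately show "e \<in> \<Union>(segments E)" using * by blast
  qed
qed

definition cycle_segments :: "'a set set set" where
  "cycle_segments = {s \<in> segments E. s \<inter> C \<noteq> {}}"

lemma cycle_segments_subset: "cycle_segments \<subseteq> segments E"
  by (auto simp: cycle_segments_def)

text \<open>A segment that meets the cycle lies on it entirely, because the cycle is closed at
  vertices of degree 2.\<close>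

lemma Union_cycle_segments: "\<Union>cycle_segments = C"
proof
  show "\<Union>cycle_segments \<subseteq> C"
    unfolding cycle_segments_def segments_def
    using segment_subset_closed[OF _ cycle_deg2_closed] by blast
  show "C \<subseteq> \<Union>cycle_segments"
    using Union_segments cycle_subset unfolding cycle_segments_def by blast
qed

lemma card_cycle: "card C = (\<Sum>s\<in>cycle_segments. card s)"
proof -
  have "card (\<Union>cycle_segments) = (\<Sum>s\<in>cycle_segments. card s)"
  proof (rule card_Union_disjoint)
    show "pairwise disjnt cycle_segments"
      using segments_disjoint cycle_segments_subset by (auto simp: pairwise_def disjnt_def subset_iff)
    show "finite s" if "s \<in> cycle_segments" for s
      using that cycle_segments_subset segments_subset simple_graph_finite_edges[OF simple]
      by (meson finite_subset subsetD)
  qed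
  then show ?thesis by (simp add: Union_cycle_segments)
qed

text \<open>While segments are missing, one of them meets the connected part built so far in a
  single vertex \<open>u\<close>, one of its ends. If its other end also belonged to that part, a
  second cycle would arise.\<close>

lemma pendent_segment:
  assumes T: "T \<subseteq> segments E" "T \<noteq> segments E" "C \<subseteq> \<Union>T"
    and conn: "\<And>a b. a \<in> \<Union>(\<Union>T) \<Longrightarrow> b \<in> \<Union>(\<Union>T) \<Longrightarrow> (adj (\<Union>T))\<^sup>*\<^sup>* a b"
  obtains u xs where "is_segment E (u # xs)" "xs \<noteq> []" "distinct (u # xs)"
    "u \<in> \<Union>(\<Union>T)" "degree E u \<noteq> 2" "set xs \<inter> \<Union>(\<Union>T) = {}"
proof -
  define F W where "F = \<Union>T" and "W = \<Union>F"
  have FE: "F \<subseteq> E" using T(1) segments_subset unfolding F_def by blast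
  have closed: "deg2_closed E F"
    unfolding F_def by (rule deg2_closed_Union) (use T(1) segments_deg2_closed in blast)
  have CF: "C \<subseteq> F" using T(3) by (simp add: F_def)
  obtain t where t: "t \<in> segments E" "t \<notin> T" using T(1,2) by blast
  then obtain e0 where e0: "e0 \<in> t" using segments_nonempty by blast
  have e0F: "e0 \<notin> F" using e0 t T(1) segments_disjoint[OF t(1)] unfolding F_def by blast
  have e0E: "e0 \<in> E" using e0 t segments_subset by blast
  then obtain x where x: "x \<in> e0" "x \<in> V" using simple_graph_vertex[OF simple] by blast
  obtain c where c: "c \<in> C" using cycle_nonempty by blast
  then obtain a where a: "a \<in> c" "a \<in> V"
    using cycle_subset simple_graph_vertex[OF simple] by blast
  have "a \<in> W" using a c CF by (auto simp: W_def)
  \<comment> \<open>Otherwise no walk could leave \<open>W\<close>, and the missing edge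
    \<open>e0\<close> would have an end in \<open>W\<close> after all.\<close>
  have "\<exists>u\<in>W. \<exists>e\<in>E. u \<in> e \<and> e \<notin> F"
  proof (rule ccontr)
    assume no: "\<not> ?thesis"
    have "(adj E)\<^sup>*\<^sup>* a x" using connected a x unfolding connected_graph_def by blast
    then have "x \<in> W"
    proof (induction rule: rtranclp_induct)
      case (step y z)
      then have "{y, z} \<in> F" using no by (auto simp: adj_def)
      then show ?case by (auto simp: W_def)
    qed (rule \<open>a \<in> W\<close>)
    then show False using no x e0E e0F by blast
  qed
  then obtain u e where ue: "u \<in> W" "e \<in> E" "u \<in> e" "e \<notin> F" by blast
  obtain e' where e': "e' \<in> F" "u \<in> e'" using ue(1) unfolding W_def by blast
  \<comment> \<open>At degree 2, closedness of \<open>F\<close> would force \<open>e\<close> into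
    \<open>F\<close>.\<close>
  have degu: "degree E u \<noteq> 2" using deg2_closedD[OF closed _ e' ue(2,3)] ue(4) by blast
  obtain w where w: "e = {u, w}" using simple_graph_incident[OF simple ue(2,3)] .
  obtain p where p: "is_segment E p" "hd p = u" "p ! 1 = w"
    using segment_from[OF simple degu] ue(2) w by metis
  have len: "length p \<ge> 2" and dp: "distinct (butlast p)" "distinct (tl p)"
    and closed_len: "hd p = last p \<Longrightarrow> length p \<ge> 4"
    using p(1) by (simp_all add: is_segment_def)
  have "p \<noteq> []" using len by auto
  have "p ! 0 = u" using p(2) \<open>p \<noteq> []\<close> by (simp add: hd_conv_nth)
  then have "e \<in> seg_edges p" using p(3) w len unfolding seg_edges_def by fastforce
  then have disj: "seg_edges p \<inter> F = {}"
    using segment_subset_closed[OF p(1) closed] ue(4) by blast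
  have sub: "seg_edges p \<subseteq> E" using seg_edges_subset[OF p(1)] .
  \<comment> \<open>An inner vertex has degree 2; if it lay in \<open>W\<close>, closedness would
    put an edge of the segment into \<open>F\<close>.\<close>
  have inner: "v \<notin> W" if v: "v \<in> set p" "v \<noteq> u" "v \<noteq> last p" for v
  proof
    assume "v \<in> W"
    then obtain f where f: "f \<in> F" "v \<in> f" unfolding W_def by blast
    obtain g where g: "g \<in> seg_edges p" "v \<in> g" using Union_seg_edges[OF len] v(1) by blast
    have "degree E v = 2" using segment_endpoints[OF p(1) v(1)] v p(2) by blast
    then have "g \<in> F" using deg2_closedD[OF closed _ f] g sub by blast
    then show False using g disj by blast
  qed
  have no_cycle: "\<not> seg_edges p \<subseteq> C" using \<open>e \<in> seg_edges p\<close> ue(4) CF by blast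
  define z where "z = last p"
  have pz: "p = butlast p @ [z]" using \<open>p \<noteq> []\<close> by (simp add: z_def)
  have bp: "butlast p \<noteq> []" "hd (butlast p) = u"
    using butlast_hd[OF len] p(2) by simp_all
  have pe: "seg_edges p = insert {last (butlast p), z} (seg_edges (butlast p))"
    using seg_edges_snoc[OF bp(1), of z] pz by simp
  \<comment> \<open>A segment returning to \<open>u\<close> would itself be a cycle, and not
    \<open>C\<close>, since \<open>e\<close> is not in \<open>C\<close>.\<close>
  have "z \<noteq> u"
  proof
    assume "z = u"
    then have "length p \<ge> 4" using closed_len p(2) z_def by simp
    moreover have "cycle_edges (butlast p) = seg_edges p"
      using bp(2) \<open>z = u\<close> by (simp add: cycle_edges_def pe)
    ultimately have "is_cycle E (seg_edges p)"
      unfolding is_cycle_iff using dp(1) sub by (intro exI[of _ "butlast p"]) auto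
    then show False using cycle_unique no_cycle by blast
  qed
  \<comment> \<open>By \<open>inner\<close> only \<open>z\<close> could be another exception, and by
    distinctness of \<open>tl p\<close> it occurs there only as the last vertex.\<close>
  have butlast_W: "v = u" if "v \<in> set (butlast p)" "v \<in> W" for v
  proof (rule ccontr)
    assume "v \<noteq> u"
    then have "v = z" using inner[of v] that in_set_butlastD z_def by fastforce
    obtain q where q: "p = u # q" using p(2) \<open>p \<noteq> []\<close> by (cases p) auto
    then have "q \<noteq> []" "butlast p = u # butlast q" using len by auto
    then have "v \<in> set (butlast q)" using that \<open>v \<noteq> u\<close> by auto
    moreover have "q = butlast q @ [z]" using q \<open>q \<noteq> []\<close> by (simp add: z_def)
    then have "z \<notin> set (butlast q)" using dp(2) q by (metis distinct_butlast distinct_append list.sel(3) IntI empty_iff list.set_intros(1))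
    ultimately show False using \<open>v = z\<close> by blast
  qed
  \<comment> \<open>Otherwise a path \<open>q\<close> inside \<open>F\<close> from \<open>z\<close>
    back to \<open>u\<close> closes the segment up to a cycle that contains \<open>e\<close> and
    hence differs from \<open>C\<close>.\<close>
  have "z \<notin> W"
  proof
    assume "z \<in> W"
    then have "(adj F)\<^sup>*\<^sup>* z u" using conn ue(1) by (simp add: F_def W_def)
    then obtain q where q: "q \<noteq> []" "hd q = z" "last q = u" "distinct q" "seg_edges q \<subseteq> F"
      using rtranclp_adj_path by metis
    have qlen: "length q \<ge> 2"
      using q(1-3) \<open>z \<noteq> u\<close> by (cases q; cases "tl q") auto
    have qu: "q = butlast q @ [u]" using q(1,3) by (metis append_butlast_last_id)
    have bq: "butlast q \<noteq> []" "hd (butlast q) = z" using butlast_hd[OF qlen] q(2) by simp_all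
    have qe: "seg_edges q = insert {last (butlast q), u} (seg_edges (butlast q))"
      using seg_edges_snoc[OF bq(1), of u] qu by simp
    have qW: "set q \<subseteq> W" using Union_seg_edges[OF qlen] q(5) unfolding W_def by blast
    have "u \<notin> set (butlast q)" using q(4) qu by (metis distinct_append IntI empty_iff list.set_intros(1))
    then have "set (butlast p) \<inter> set (butlast q) = {}"
      using butlast_W qW in_set_butlastD by fastforce
    then have d: "distinct (butlast p @ butlast q)"
      using dp(1) q(4) by (simp add: distinct_butlast)
    have ce: "cycle_edges (butlast p @ butlast q) = seg_edges p \<union> seg_edges q"
      using bp bq by (auto simp: cycle_edges_def seg_edges_append pe qe)
    \<comment> \<open>Excludes the degenerate closed walk that runs through one edge twice; the
      cycle then has at least 3 vertices.\<close>
    have "length p + length q \<noteq> 4"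
    proof
      assume "length p + length q = 4"
      then have "length p = 2" "length q = 2" using len qlen by auto
      then have "p = [u, z]" "q = [z, u]"
        using p(2) q(2,3) by (auto simp: length_Suc_conv numeral_2_eq_2 z_def)
      then have "{u, z} \<in> seg_edges p \<inter> F" using q(5) by (auto simp: insert_commute)
      then show False using disj by blast
    qed
    then have "length (butlast p @ butlast q) \<ge> 3" using len qlen by simp
    then have "is_cycle E (seg_edges p \<union> seg_edges q)"
      unfolding is_cycle_iff using d ce sub q(5) FE by (intro exI[of _ "butlast p @ butlast q"]) auto
    then show False using cycle_unique no_cycle by blast
  qed
  obtain xs where xs: "p = u # xs" using p(2) \<open>p \<noteq> []\<close> by (cases p) auto
  have "xs \<noteq> []" using xs len by auto
  have xsz: "xs = butlast xs @ [z]" using xs \<open>xs \<noteq> []\<close> by (simp add: z_def)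
  have "distinct (u # butlast xs)" using dp(1) xs \<open>xs \<noteq> []\<close> by simp
  moreover have "set xs = insert z (set (butlast xs))" using xsz by (metis set_append list.simps(15) Un_insert_right list.set(1) sup_bot.right_neutral)
  ultimately have "u \<notin> set xs" using \<open>z \<noteq> u\<close> by auto
  then have "set xs \<inter> W = {}" using inner \<open>z \<notin> W\<close> xs by (auto simp: z_def)
  then show ?thesis
    using that[of u xs] p(1) xs \<open>xs \<noteq> []\<close> \<open>u \<notin> set xs\<close> dp(2) ue(1) degu
    by (simp add: W_def F_def)
qed

end

section \<open>Fibonacci products and the growth invariant\<close>

text \<open>For pendent paths with these lengths, \<open>k = 2\<close> gives the index of what
  remains when the attaching vertices are deleted; for \<open>k = 1\<close> the first new vertex of
  each path is deleted too.\<close>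

definition fib_prod :: "nat \<Rightarrow> 'a set set \<Rightarrow> nat" where
  "fib_prod k T = (\<Prod>s\<in>T. fib (card s + k))"

lemma fib_prod_empty [simp]: "fib_prod k {} = 1"
  by (simp add: fib_prod_def)

lemma fib_prod_insert: "finite T \<Longrightarrow> s \<notin> T \<Longrightarrow> fib_prod k (insert s T) = fib (card s + k) * fib_prod k T"
  by (simp add: fib_prod_def)

lemma fib_prod_Un: "finite T \<Longrightarrow> finite T' \<Longrightarrow> T \<inter> T' = {} \<Longrightarrow> fib_prod k (T \<union> T') = fib_prod k T * fib_prod k T'"
  by (simp add: fib_prod_def prod.union_disjoint)

lemma fib_prod_mono: "fib_prod 1 T \<le> fib_prod 2 T"
  unfolding fib_prod_def by (intro prod_mono) (auto intro: fib_mono)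

context unicyclic_graph
begin

text \<open>Invariant of the growth: \<open>T\<close> is the set of segments present, and the two
  products are the pair \<open>(X, Y)\<close>. Vertex deletions are controlled only at degree other
  than 2, since only there a further segment can be attached.\<close>

definition grown :: "nat \<Rightarrow> nat \<Rightarrow> 'a set set set \<Rightarrow> bool" where
  "grown x y T \<longleftrightarrow> cycle_segments \<subseteq> T \<and> T \<subseteq> segments E \<and>
    (\<forall>a\<in>\<Union>(\<Union>T). \<forall>b\<in>\<Union>(\<Union>T). (adj (\<Union>T))\<^sup>*\<^sup>* a b) \<and>
    sigma (\<Union>(\<Union>T)) (\<Union>T) \<le> x * fib_prod 2 (T - cycle_segments) + y * fib_prod 1 (T - cycle_segments) \<and>
    (\<forall>v\<in>\<Union>(\<Union>T). degree E v \<noteq> 2 \<longrightarrow>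
      sigma (\<Union>(\<Union>T) - {v}) (\<Union>T) \<le> x * fib_prod 2 (T - cycle_segments))"

text \<open>The cycle attains these two Fibonacci bounds exactly. The pair \<open>x\<close>,
  \<open>y\<close> is kept free so that it may also come from a shorter cycle.\<close>

lemma grown_cycle:
  assumes "fib (card C + 1) \<le> x" "fib (card C + 1) + fib (card C - 1) \<le> x + y"
  shows "grown x y cycle_segments"
proof -
  obtain vs where vs: "length vs \<ge> 3" "distinct vs" "C = cycle_edges vs"
    using cycle unfolding is_cycle_iff by blast
  have UC: "\<Union>C = set vs" unfolding vs(3) using vs(1) by (simp add: Union_cycle_edges)
  have n: "card C = length vs" unfolding vs(3) using vs by (simp add: card_cycle_edges)
  have sub: "seg_edges vs \<subseteq> C" by (auto simp: vs(3) cycle_edges_def)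
  have hd: "(adj C)\<^sup>*\<^sup>* (hd vs) a" if "a \<in> set vs" for a
    using adj_mono[OF sub adj_path[OF that]] .
  have "hd vs \<in> set vs" using vs(1) by (cases vs) auto
  from sigma_cycle_eq[OF vs(1,2) this]
  have "sigma (\<Union>C) C = fib (card C + 1) + fib (card C - 1)"
    unfolding UC n vs(3)[symmetric] .
  moreover have "sigma (\<Union>C - {v}) C = fib (card C + 1)" if "v \<in> set vs" for v
    using sigma_cycle_minus[OF vs(1,2) that] unfolding UC n vs(3)[symmetric] .
  moreover have "(adj C)\<^sup>*\<^sup>* a b" if "a \<in> set vs" "b \<in> set vs" for a b
    using adj_rtranclp_sym[OF hd[OF that(1)]] hd[OF that(2)] by (rule rtranclp_trans)
  ultimately show ?thesis
    unfolding grown_def Union_cycle_segments UC using assms cycle_segments_subset by simp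
qed

text \<open>A pendent path of length \<open>l\<close> turns \<open>(X, Y)\<close> into
  \<open>(X * fib (l + 2), Y * fib (l + 1))\<close>. For the deletion bound the deleted vertex is
  either old or the far end of the new path.\<close>

lemma grown_step:
  assumes T: "grown x y T" "T \<noteq> segments E" and "y \<le> x"
  shows "\<exists>s. s \<in> segments E - T \<and> grown x y (insert s T)"
proof -
  define F W where "F = \<Union>T" and "W = \<Union>F"
  let ?A = "fib_prod 2 (T - cycle_segments)" and ?B = "fib_prod 1 (T - cycle_segments)"
  have cT: "cycle_segments \<subseteq> T" and TS: "T \<subseteq> segments E"
    and conn: "\<And>a b. a \<in> W \<Longrightarrow> b \<in> W \<Longrightarrow> (adj F)\<^sup>*\<^sup>* a b"
    and sW: "sigma W F \<le> x * ?A + y * ?B"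
    and sv: "\<And>v. v \<in> W \<Longrightarrow> degree E v \<noteq> 2 \<Longrightarrow> sigma (W - {v}) F \<le> x * ?A"
    using T(1) unfolding grown_def F_def[symmetric] W_def[symmetric] by simp_all
  have "C \<subseteq> F" using Union_cycle_segments cT unfolding F_def by blast
  then obtain u xs where p: "is_segment E (u # xs)" "xs \<noteq> []" "distinct (u # xs)"
    "u \<in> W" "degree E u \<noteq> 2" "set xs \<inter> W = {}"
    using pendent_segment[OF TS T(2)] conn unfolding F_def[symmetric] W_def[symmetric] by metis
  define s l where "s = seg_edges (u # xs)" and "l = length xs"
  have sS: "s \<in> segments E" using p(1) by (auto simp: s_def segments_def)
  have us: "\<Union>s = set (u # xs)"
    unfolding s_def using p(2) by (intro Union_seg_edges) (cases xs; simp)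
  have last_s: "last xs \<in> \<Union>s" using us p(2) by simp
  have "last xs \<notin> W" using p(2,6) last_in_set by blast
  then have "s \<notin> T" using last_s unfolding W_def F_def by blast
  have cs: "card s = l" unfolding s_def l_def using card_seg_edges[OF p(3)] by simp
  have finV: "finite V" using simple by (simp add: simple_graph_def)
  have FE: "F \<subseteq> E" using TS segments_subset unfolding F_def by blast
  have "W \<subseteq> V" unfolding W_def using FE simple_graph_subset[OF simple] by blast
  then have finW: "finite W" using finV finite_subset by blast
  have two: "card e = 2" if "e \<in> F" for e
  proof -
    have "e \<in> E" using that FE by blast
    then obtain a b where "e = {a, b}" "a \<noteq> b" using simple unfolding simple_graph_def by blast
    then show ?thesis by simp
  qed
  have F': "\<Union>(insert s T) = F \<union> s" by (auto simp: F_def)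
  have W': "\<Union>(F \<union> s) = W \<union> set xs"
    unfolding Union_Un_distrib us using p(4) by (auto simp: W_def)
  have "finite (T - cycle_segments)" using TS finite_segments finite_subset by blast
  moreover have "insert s T - cycle_segments = insert s (T - cycle_segments)"
    using \<open>s \<notin> T\<close> cT by blast
  ultimately have prods: "fib_prod k (insert s T - cycle_segments) = fib (l + k) * fib_prod k (T - cycle_segments)" for k
    using \<open>s \<notin> T\<close> cs by (simp add: fib_prod_insert)
  let ?X = "x * ?A" and ?Y = "y * ?B"
  have YX: "?Y \<le> ?X" using \<open>y \<le> x\<close> fib_prod_mono by (intro mult_mono) auto
  have fib2: "fib (l + 2) = fib (l + 1) + fib l" by (simp add: numeral_2_eq_2)
  have attach: "sigma (W' \<union> set ys) (F \<union> seg_edges (u # ys))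
      = fib (length ys + 1) * sigma W' F + fib (length ys) * sigma (W' - {u}) F"
    if "W' \<subseteq> W" "distinct (u # ys)" "set ys \<subseteq> set xs" for W' ys
  proof (rule sigma_attach_path)
    show "finite W'" using that(1) finW by (rule finite_subset)
    show "set ys \<inter> W' = {}" using that p(6) by blast
    show "set ys \<inter> \<Union>F = {}" using that p(6) unfolding W_def by blast
  qed (use two that in auto)
  have "sigma (W \<union> set xs) (F \<union> s) = fib (l + 1) * sigma W F + fib l * sigma (W - {u}) F"
    unfolding s_def l_def by (rule attach[OF order_refl p(3) order_refl])
  also have "\<dots> \<le> fib (l + 1) * (?X + ?Y) + fib l * ?X"
    using sW sv[OF p(4,5)] by (intro add_mono mult_left_mono) auto
  also have "\<dots> = ?X * fib (l + 2) + ?Y * fib (l + 1)"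
    unfolding fib2 by (simp add: algebra_simps)
  finally have sigma': "sigma (W \<union> set xs) (F \<union> s) \<le> ?X * fib (l + 2) + ?Y * fib (l + 1)" .
  have minus: "sigma (W \<union> set xs - {v}) (F \<union> s) \<le> ?X * fib (l + 2)"
    if v: "v \<in> W \<union> set xs" "degree E v \<noteq> 2" for v
  proof (cases "v \<in> W")
    case True
    then have "v \<notin> set xs" using p(6) by blast
    then have W_v: "W \<union> set xs - {v} = (W - {v}) \<union> set xs" by blast
    have "sigma (W \<union> set xs - {v}) (F \<union> s)
        = fib (l + 1) * sigma (W - {v}) F + fib l * sigma (W - {v} - {u}) F"
      unfolding W_v s_def l_def by (rule attach[OF _ p(3) order_refl]) blast
    \<comment> \<open>Deleting \<open>u\<close> as well cannot increase the index; this includes the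
      case \<open>v = u\<close>.\<close>
    also have "\<dots> \<le> fib (l + 1) * sigma (W - {v}) F + fib l * sigma (W - {v}) F"
      using finW by (intro add_mono mult_left_mono sigma_mono) auto
    also have "\<dots> = fib (l + 2) * sigma (W - {v}) F"
      unfolding fib2 by (simp add: algebra_simps)
    also have "\<dots> \<le> fib (l + 2) * ?X"
      using sv[OF True v(2)] by (intro mult_left_mono) auto
    finally show ?thesis by (simp add: mult.commute)
  next
    case False
    then have "v \<in> set xs" "v \<noteq> u" using v(1) p(4) by auto
    then have "v = last xs"
      using segment_endpoints[OF p(1) _ v(2)] p(2) by auto
    then obtain ys where ys: "xs = ys @ [v]" using p(2) append_butlast_last_id by metis
    then have "v \<notin> set ys" "length ys = l - 1" using p(3) by (auto simp: l_def)
    have W_v: "W \<union> set xs - {v} = W \<union> set ys" using ys \<open>v \<notin> W\<close> \<open>v \<notin> set ys\<close> by auto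
    have l: "l > 0" using p(2) by (simp add: l_def)
    then obtain m where m: "l = Suc m" by (cases l) auto
    have "sigma (W \<union> set ys) (F \<union> s) = sigma (W \<union> set ys) (F \<union> seg_edges (u # ys))"
    proof (rule sigma_cong)
      fix e assume e: "e \<subseteq> W \<union> set ys"
      have "s = insert {last (u # ys), v} (seg_edges (u # ys))"
        using seg_edges_snoc[of "u # ys" v] ys by (simp add: s_def)
      moreover have "e \<noteq> {last (u # ys), v}" using e \<open>v \<notin> W\<close> \<open>v \<notin> set ys\<close> by auto
      ultimately show "e \<in> F \<union> s \<longleftrightarrow> e \<in> F \<union> seg_edges (u # ys)" by simp
    qed
    also have "\<dots> = fib (m + 1) * sigma W F + fib m * sigma (W - {u}) F"
      using attach[OF order_refl, of ys] \<open>length ys = l - 1\<close> m p(3) ys by (simp add: subset_insertI)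
    \<comment> \<open>Deleting the far end leaves a path shorter by one. Here
      \<open>Y \<le> X\<close> enters, and
      \<open>2 * fib (m + 1) + fib m = fib (m + 3)\<close>.\<close>
    also have "\<dots> \<le> fib (m + 1) * (?X + ?X) + fib m * ?X"
      using sW YX sv[OF p(4,5)] by (intro add_mono mult_left_mono) auto
    also have "\<dots> = ?X * fib (l + 2)"
      by (simp add: m numeral_2_eq_2 algebra_simps)
    finally show ?thesis using W_v by simp
  qed
  have "grown x y (insert s T)"
    unfolding grown_def W' F' prods
  proof (intro conjI ballI impI)
    show "cycle_segments \<subseteq> insert s T" "insert s T \<subseteq> segments E" using cT TS sS by auto
    show "(adj (F \<union> s))\<^sup>*\<^sup>* a b" if "a \<in> W \<union> set xs" "b \<in> W \<union> set xs" for a b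
      unfolding s_def by (rule adj_connected_Un[OF conn]) (use that p(4) in auto)
    show "sigma (W \<union> set xs) (F \<union> s) \<le> x * (fib (l + 2) * ?A) + y * (fib (l + 1) * ?B)"
      using sigma' by (simp only: mult_ac)
    show "sigma (W \<union> set xs - {v}) (F \<union> s) \<le> x * (fib (l + 2) * ?A)"
      if "v \<in> W \<union> set xs" "degree E v \<noteq> 2" for v
      using minus[OF that] by (simp only: mult_ac)
  qed
  then show ?thesis using sS \<open>s \<notin> T\<close> by blast
qed

text \<open>Connectedness to a vertex of the cycle excludes isolated vertices.\<close>

lemma Union_edges: "\<Union>E = V"
proof
  show "\<Union>E \<subseteq> V" using simple_graph_subset[OF simple] by blast
  show "V \<subseteq> \<Union>E"
  proof
    fix v assume "v \<in> V"
    obtain c where c: "c \<in> C" using cycle_nonempty by blast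
    then have cE: "c \<in> E" using cycle_subset by blast
    obtain a where a: "a \<in> c" "a \<in> V" by (rule simple_graph_vertex[OF simple cE])
    have "(adj E)\<^sup>*\<^sup>* a v" using connected a \<open>v \<in> V\<close> unfolding connected_graph_def by blast
    then show "v \<in> \<Union>E"
    proof (cases rule: rtranclp.cases)
      case rtrancl_refl
      then show ?thesis using a cE by blast
    next
      case (rtrancl_into_rtrancl b)
      then show ?thesis by (auto simp: adj_def)
    qed
  qed
qed

text \<open>Segments are added by \<open>grown_step\<close>, starting from those on the cycle, until
  none is missing.\<close>

lemma sigma_le_cycle:
  assumes "fib (card C + 1) \<le> x" "fib (card C + 1) + fib (card C - 1) \<le> x + y" "y \<le> x"
  shows "sigma V E \<le> x * fib_prod 2 (segments E - cycle_segments) + y * fib_prod 1 (segments E - cycle_segments)"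
proof -
  have "grown x y (segments E)" if "grown x y T" for T
    using that
  proof (induction "card (segments E - T)" arbitrary: T rule: less_induct)
    case less
    show ?case
    proof (cases "T = segments E")
      case False
      then obtain s where s: "s \<in> segments E - T" "grown x y (insert s T)"
        using grown_step[OF less.prems _ assms(3)] by blast
      have "card (segments E - insert s T) < card (segments E - T)"
        by (rule psubset_card_mono) (use s(1) finite_segments in auto)
      then show ?thesis using less.hyps s(2) by blast
    qed (use less.prems in simp)
  qed
  then have "grown x y (segments E)" using grown_cycle[OF assms(1,2)] by blast
  then show ?thesis unfolding grown_def Union_segments Union_edges by blast
qed

text \<open>The right-hand side is the index of a cycle formed by the segments in \<open>B\<close> alone, with all other
  segments pendent at one vertex of it.\<close>
lemma sigma_le_cycle_part:
  assumes B: "B \<subseteq> cycle_segments" "3 \<le> (\<Sum>s\<in>B. card s)"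
  shows "sigma V E \<le> fib ((\<Sum>s\<in>B. card s) + 1) * fib_prod 2 (segments E - B)
    + fib ((\<Sum>s\<in>B. card s) - 1) * fib_prod 1 (segments E - B)"
proof -
  define b x y where "b = (\<Sum>s\<in>B. card s)" and "x = fib (b + 1)" and "y = fib (b - 1)"
  have b: "b \<ge> 3" using B(2) by (simp add: b_def)
  have fin: "finite cycle_segments" using finite_subset[OF cycle_segments_subset finite_segments] .
  \<comment> \<open>Lengthening the cycle by a further segment costs no more than attaching that
    segment as a pendent path. The induction runs over the cycle segments outside
    \<open>B\<close>.\<close>
  have "finite D \<Longrightarrow> fib (b + (\<Sum>s\<in>D. card s) + 1) \<le> x * fib_prod 2 D \<and>
    fib (b + (\<Sum>s\<in>D. card s) + 1) + fib (b + (\<Sum>s\<in>D. card s) - 1) \<le> x * fib_prod 2 D + y * fib_prod 1 D"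
    for D :: "'a set set set"
  proof (induction D rule: finite_induct)
    case (insert s D)
    define d X Y where "d = card s" and "X = x * fib_prod 2 D" and "Y = y * fib_prod 1 D"
    \<comment> \<open>The shift by 2 removes the truncated subtraction, so that the addition formula
      for Fibonacci numbers applies to both indices.\<close>
    define c where "c = b + (\<Sum>s\<in>D. card s) - 2"
    have c: "b + (\<Sum>s\<in>D. card s) = c + 2" using b by (simp add: c_def)
    have IH: "fib (c + 3) \<le> X" "fib (c + 3) + fib (c + 1) \<le> X + Y"
      using insert.IH unfolding c X_def Y_def by (simp_all add: numeral_3_eq_3)
    have fd: "fib (d + 2) = fib (d + 1) + fib d" by (simp add: numeral_2_eq_2)
    have 1: "fib (c + 2 + d + 1) = fib (c + 3) * fib (d + 1) + fib (c + 2) * fib d"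
      using fib_add[of "c + 2" d] by (simp add: eval_nat_numeral algebra_simps)
    have 2: "fib (c + 2 + d - 1) = fib (c + 1) * fib (d + 1) + fib c * fib d"
      using fib_add[of c d] by (simp add: algebra_simps)
    have 3: "fib (c + 3) = fib (c + 2) + fib (c + 1)" "fib c \<le> fib (c + 1)"
      by (simp_all add: eval_nat_numeral fib_mono)
    have "fib (c + 2 + d + 1) \<le> fib (c + 3) * fib (d + 1) + fib (c + 3) * fib d"
      unfolding 1 by (intro add_mono mult_right_mono) (simp_all add: 3)
    also have "\<dots> \<le> X * fib (d + 2)"
      using mult_right_mono[OF IH(1), of "fib (d + 2)"] unfolding fd by (simp add: algebra_simps)
    finally have A: "fib (c + 2 + d + 1) \<le> X * fib (d + 2)" .
    have "fib (c + 2 + d + 1) + fib (c + 2 + d - 1)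
        = (fib (c + 3) + fib (c + 1)) * fib (d + 1) + (fib (c + 2) + fib c) * fib d"
      unfolding 1 2 by (simp add: algebra_simps)
    also have "\<dots> \<le> (X + Y) * fib (d + 1) + X * fib d"
    proof (rule add_mono)
      have "fib (c + 2) + fib c \<le> X" using IH(1) 3 by linarith
      then show "(fib (c + 2) + fib c) * fib d \<le> X * fib d" by (rule mult_right_mono) simp
      show "(fib (c + 3) + fib (c + 1)) * fib (d + 1) \<le> (X + Y) * fib (d + 1)"
        using IH(2) by (rule mult_right_mono) simp
    qed
    also have "\<dots> = X * fib (d + 2) + Y * fib (d + 1)"
      unfolding fd by (simp add: algebra_simps)
    finally have A': "fib (c + 2 + d + 1) + fib (c + 2 + d - 1) \<le> X * fib (d + 2) + Y * fib (d + 1)" .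
    have s: "b + (\<Sum>s\<in>insert s D. card s) = c + 2 + d"
      using insert.hyps c by (simp add: d_def)
    have p: "x * fib_prod 2 (insert s D) = X * fib (d + 2)" "y * fib_prod 1 (insert s D) = Y * fib (d + 1)"
      using insert.hyps by (simp_all add: fib_prod_insert X_def Y_def d_def)
    show ?case unfolding s p using A A' by blast
  qed (simp add: x_def y_def)
  from this[of "cycle_segments - B"]
  have D: "fib (card C + 1) \<le> x * fib_prod 2 (cycle_segments - B)"
    "fib (card C + 1) + fib (card C - 1) \<le> x * fib_prod 2 (cycle_segments - B) + y * fib_prod 1 (cycle_segments - B)"
    using fin B(1) card_cycle sum.subset_diff[OF B(1) fin, of card] by (simp_all add: b_def add.commute)
  have "y \<le> x" unfolding x_def y_def by (rule fib_mono) simp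
  then have "y * fib_prod 1 (cycle_segments - B) \<le> x * fib_prod 2 (cycle_segments - B)"
    using fib_prod_mono by (intro mult_mono) auto
  from sigma_le_cycle[OF D this]
  have "sigma V E \<le> x * fib_prod 2 (cycle_segments - B) * fib_prod 2 (segments E - cycle_segments)
    + y * fib_prod 1 (cycle_segments - B) * fib_prod 1 (segments E - cycle_segments)" .
  moreover have "fib_prod k (segments E - B)
      = fib_prod k (cycle_segments - B) * fib_prod k (segments E - cycle_segments)" for k
  proof -
    have "segments E - B = (cycle_segments - B) \<union> (segments E - cycle_segments)"
      using B(1) cycle_segments_subset by blast
    then show ?thesis using fin finite_segments by (simp add: fib_prod_Un Diff_Int_distrib2 Int_Diff)
  qed
  ultimately show ?thesis by (simp add: x_def y_def b_def mult.assoc)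
qed

text \<open>With \<open>B = {s}\<close> the bound is the index of the graph whose cycle has length
  \<open>card s\<close> and whose other segments are all pendent.\<close>

lemma sigma_le_long_cycle_segment:
  assumes "s \<in> cycle_segments" "card s \<ge> 3"
  shows "sigma V E \<le> fib (card s + 1) * fib_prod 2 (segments E - {s})
    + fib (card s - 1) * fib_prod 1 (segments E - {s})"
  using sigma_le_cycle_part[of "{s}"] assms by simp

text \<open>\<open>B\<close> consists of segments of lengths \<open>2, 2\<close> or \<open>2, 1\<close> or \<open>1, 1, 1\<close>; the case \<open>2, 2\<close> is tight in the
  last inequality.\<close>
lemma short_cycle_part:
  assumes "\<And>s. s \<in> cycle_segments \<Longrightarrow> card s \<le> 2"
  obtains B where "B \<subseteq> cycle_segments" "3 \<le> (\<Sum>s\<in>B. card s)"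
    "5 * fib ((\<Sum>s\<in>B. card s) + 1) \<le> 3 * fib_prod 2 B"
    "5 * fib ((\<Sum>s\<in>B. card s) + 1) + 3 * fib ((\<Sum>s\<in>B. card s) - 1) \<le> 3 * fib_prod 2 B + fib_prod 1 B"
proof -
  have fin: "finite cycle_segments" using finite_subset[OF cycle_segments_subset finite_segments] .
  have len: "card C \<ge> 3"
    using cycle unfolding is_cycle_iff by (auto simp: card_cycle_edges)
  have card: "card s = 1 \<or> card s = 2" if s: "s \<in> cycle_segments" for s
  proof -
    have sS: "s \<in> segments E" using s cycle_segments_subset by blast
    then have "finite s"
      using segments_subset simple_graph_finite_edges[OF simple] finite_subset by blast
    then have "card s > 0" using segments_nonempty[OF sS] by (simp add: card_gt_0_iff)
    then show ?thesis using assms[OF s] by linarith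
  qed
  show ?thesis
  proof (cases "\<exists>s\<in>cycle_segments. card s = 2")
    case True
    then obtain s where s: "s \<in> cycle_segments" "card s = 2" by blast
    \<comment> \<open>A second segment exists because the cycle has at least 3 edges and
      \<open>s\<close> only 2.\<close>
    obtain t where t: "t \<in> cycle_segments" "t \<noteq> s"
    proof (rule ccontr)
      assume "\<not> thesis"
      then have "cycle_segments = {s}" using s(1) that by blast
      then show False using card_cycle len s(2) by simp
    qed
    have "card t = 1 \<or> card t = 2" using card t(1) by blast
    then show ?thesis
      by (intro that[of "{s, t}"]; elim disjE)
        (use s t in \<open>simp_all add: fib_prod_insert numeral_eq_Suc\<close>)
  next
    case False
    then have one: "card s = 1" if "s \<in> cycle_segments" for s using card that by blast
    then have "card cycle_segments \<ge> 3" using card_cycle len by simp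
    then obtain B where B: "B \<subseteq> cycle_segments" "card B = 3"
      by (meson obtain_subset_with_card_n)
    have "(\<Sum>s\<in>B. card s) = (\<Sum>s\<in>B. 1)" by (rule sum.cong) (use B one in auto)
    then have "(\<Sum>s\<in>B. card s) = 3" using B(2) by simp
    moreover have "fib_prod k B = fib (1 + k) ^ 3" for k
    proof -
      have "fib_prod k B = (\<Prod>s\<in>B. fib (1 + k))"
        unfolding fib_prod_def by (rule prod.cong) (use B one in auto)
      then show ?thesis using B(2) by simp
    qed
    ultimately show ?thesis
      by (intro that[of B]) (use B(1) in \<open>simp_all add: numeral_eq_Suc\<close>)
  qed
qed

text \<open>An exchange: the bound with \<open>B\<close> on the cycle and \<open>s\<close> pendent
  is at most the value with \<open>s\<close> as the cycle and \<open>B\<close> pendent.\<close>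

lemma sigma_le_short_cycle_segments:
  assumes "\<And>s. s \<in> cycle_segments \<Longrightarrow> card s \<le> 2" and s: "s \<in> segments E" "card s \<ge> 3"
  shows "sigma V E \<le> fib (card s + 1) * fib_prod 2 (segments E - {s})
    + fib (card s - 1) * fib_prod 1 (segments E - {s})"
proof -
  obtain B where B: "B \<subseteq> cycle_segments" "3 \<le> (\<Sum>s\<in>B. card s)"
    "5 * fib ((\<Sum>s\<in>B. card s) + 1) \<le> 3 * fib_prod 2 B"
    "5 * fib ((\<Sum>s\<in>B. card s) + 1) + 3 * fib ((\<Sum>s\<in>B. card s) - 1) \<le> 3 * fib_prod 2 B + fib_prod 1 B"
    using short_cycle_part assms(1) by blast
  define x y l D where "x = fib ((\<Sum>s\<in>B. card s) + 1)" and "y = fib ((\<Sum>s\<in>B. card s) - 1)"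
    and "l = card s" and "D = segments E - B - {s}"
  have "s \<notin> B"
  proof
    assume "s \<in> B"
    then have "card s \<le> 2" using assms(1) B(1) by blast
    then show False using s(2) by simp
  qed
  have finB: "finite B"
    using finite_subset[OF subset_trans[OF B(1) cycle_segments_subset] finite_segments] .
  have finD: "finite D" using finite_segments by (simp add: D_def)
  have 1: "fib_prod k (segments E - B) = fib (l + k) * fib_prod k D" for k
  proof -
    have "segments E - B = insert s D" using s \<open>s \<notin> B\<close> by (auto simp: D_def)
    moreover have "s \<notin> D" by (simp add: D_def)
    ultimately show ?thesis using finD by (simp add: fib_prod_insert l_def)
  qed
  have 2: "fib_prod k (segments E - {s}) = fib_prod k B * fib_prod k D" for k
  proof -
    have "segments E - {s} = B \<union> D"
      using B(1) cycle_segments_subset \<open>s \<notin> B\<close> by (auto simp: D_def)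
    moreover have "B \<inter> D = {}" by (auto simp: D_def)
    ultimately show ?thesis using finB finD by (simp add: fib_prod_Un)
  qed
  define m where "m = l - 3"
  have m: "l = m + 3" using s(2) by (simp add: m_def l_def)
  define p q where "p = fib_prod 2 D" and "q = fib_prod 1 D"
  obtain d where d: "p = q + d" using fib_prod_mono[of D] by (auto simp: p_def q_def le_iff_add)
  \<comment> \<open>The source of the constants 5 and 3: both bounds hold for all
    \<open>l \<ge> 3\<close>, with equality at \<open>l = 3\<close>.\<close>
  have f: "3 * fib (l + 2) \<le> 5 * fib (l + 1)" "fib (l + 1) \<le> 3 * fib (l - 1)"
  proof -
    have "fib (m + 1) \<le> fib (m + 2)" "fib m \<le> fib (m + 1)" by (simp_all add: fib_mono)
    then show "3 * fib (l + 2) \<le> 5 * fib (l + 1)" "fib (l + 1) \<le> 3 * fib (l - 1)"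
      by (simp_all add: m numeral_eq_Suc)
  qed
  \<comment> \<open>With \<open>p = q + d\<close>, the first inequality for \<open>B\<close> is
    weighted by \<open>d\<close>, the second by \<open>q\<close>.\<close>
  have xy: "5 * x * p + 3 * y * q \<le> 3 * fib_prod 2 B * p + fib_prod 1 B * q"
    using add_mono[OF mult_right_mono[OF B(3) zero_le, of d] mult_right_mono[OF B(4) zero_le, of q]]
    unfolding x_def[symmetric] y_def[symmetric] by (simp add: d algebra_simps)
  have "3 * (x * (fib (l + 2) * p) + y * (fib (l + 1) * q))
      = 3 * fib (l + 2) * (x * p) + fib (l + 1) * (3 * y * q)"
    by (simp add: algebra_simps)
  also have "\<dots> \<le> 5 * fib (l + 1) * (x * p) + fib (l + 1) * (3 * y * q)"
    using f(1) by (intro add_mono mult_right_mono) auto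
  also have "\<dots> = fib (l + 1) * (5 * x * p + 3 * y * q)"
    by (simp add: algebra_simps)
  also have "\<dots> \<le> fib (l + 1) * (3 * fib_prod 2 B * p + fib_prod 1 B * q)"
    using xy by (rule mult_left_mono) simp
  also have "\<dots> = fib (l + 1) * (3 * fib_prod 2 B * p) + fib (l + 1) * (fib_prod 1 B * q)"
    by (simp add: algebra_simps)
  also have "\<dots> \<le> fib (l + 1) * (3 * fib_prod 2 B * p) + 3 * fib (l - 1) * (fib_prod 1 B * q)"
    using f(2) by (intro add_mono mult_right_mono) auto
  also have "\<dots> = 3 * (fib (l + 1) * (fib_prod 2 B * p) + fib (l - 1) * (fib_prod 1 B * q))"
    by (simp add: algebra_simps)
  finally have "x * (fib (l + 2) * p) + y * (fib (l + 1) * q)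
      \<le> fib (l + 1) * (fib_prod 2 B * p) + fib (l - 1) * (fib_prod 1 B * q)"
    by simp
  moreover have "sigma V E \<le> x * (fib (l + 2) * p) + y * (fib (l + 1) * q)"
    using sigma_le_cycle_part[OF B(1,2)] unfolding 1 x_def y_def p_def q_def .
  ultimately show ?thesis unfolding 2 p_def q_def l_def by linarith
qed

end

section \<open>The graphs \<open>U\<^sub>i\<close>\<close>

text \<open>An arbitrary finite set \<open>J\<close> of pendent paths allows induction. The value
  without the centre is carried along because the attachment formula needs it.\<close>

lemma sigma_U_partial:
  fixes n :: nat and l :: "nat \<Rightarrow> nat"
  assumes "n \<ge> 3" "finite J"
  defines "W \<equiv> \<lambda>J. {(0::nat, t) | t. t < n} \<union> {(Suc j, t) | j t. j \<in> J \<and> 1 \<le> t \<and> t \<le> l j}"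
    and "F \<equiv> \<lambda>J. {{(0::nat, t), (0, (t + 1) mod n)} | t. t < n} \<union> {{pv j t, pv j (t + 1)} | j t. j \<in> J \<and> t < l j}"
  shows "sigma (W J) (F J) = fib (n + 1) * (\<Prod>j\<in>J. fib (l j + 2)) + fib (n - 1) * (\<Prod>j\<in>J. fib (l j + 1))
    \<and> sigma (W J - {(0, 0)}) (F J) = fib (n + 1) * (\<Prod>j\<in>J. fib (l j + 2))"
  using \<open>finite J\<close>
proof (induction J rule: finite_induct)
  case empty
  define vs where "vs = map (Pair (0::nat)) [0..<n]"
  have vs: "length vs \<ge> 3" "distinct vs" "(0, 0) \<in> set vs" "length vs = n" "vs \<noteq> []"
    using assms(1) by (auto simp: vs_def distinct_map inj_on_def)
  have W: "W {} = set vs" by (auto simp: W_def vs_def)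
  have nth: "vs ! t = (0, t)" if "t < n" for t using that by (simp add: vs_def)
  have "F {} = (\<lambda>t. {(0, t), (0, (t + 1) mod n)}) ` {..<n}" by (auto simp: F_def)
  also have "\<dots> = (\<lambda>t. {vs ! t, vs ! ((t + 1) mod n)}) ` {..<n}"
    by (rule image_cong) (use assms(1) nth in auto)
  also have "\<dots> = {{vs ! t, vs ! ((t + 1) mod length vs)} | t. t < length vs}"
    unfolding vs(4) by auto
  also have "\<dots> = cycle_edges vs" by (rule cycle_edges_nth[OF vs(5)])
  finally have F: "F {} = cycle_edges vs" .
  show ?case unfolding W F
    using sigma_cycle_eq[OF vs(1-3)] sigma_cycle_minus[OF vs(1-3)] vs(4) by simp
next
  case (insert j J)
  define xs where "xs = map (pv j) [1..<Suc (l j)]"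
  have xs0: "(0, 0) # xs = map (pv j) [0..<Suc (l j)]"
    by (subst upt_conv_Cons) (auto simp: xs_def pv_def)
  have len: "length xs = l j" by (simp add: xs_def)
  have setxs: "set xs = {(Suc j, t) | t. 1 \<le> t \<and> t \<le> l j}" by (auto simp: xs_def pv_def)
  have dist: "distinct ((0, 0) # xs)"
    unfolding xs0 by (auto simp: distinct_map inj_on_def pv_def split: if_splits)
  have W': "W (insert j J) = W J \<union> set xs" unfolding setxs by (auto simp: W_def)
  have F': "F (insert j J) = F J \<union> seg_edges ((0, 0) # xs)"
    unfolding xs0 seg_edges_map_upt by (auto simp: F_def)
  have fin: "finite (W J)"
  proof (rule finite_subset)
    show "W J \<subseteq> {0} \<times> {..<n} \<union> (\<Union>j\<in>J. {Suc j} \<times> {..l j})" by (auto simp: W_def)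
  qed (use insert.hyps in auto)
  have two: "card e = 2" if "e \<in> F J" for e
  proof -
    have "t \<noteq> (t + 1) mod n" if "t < n" for t
    proof (cases "t + 1 = n")
      case False
      then show ?thesis using that by simp
    qed (use assms(1) in auto)
    then show ?thesis using that by (auto simp: F_def pv_def)
  qed
  have FW: "\<Union>(F J) \<subseteq> W J"
    using assms(1) by (auto simp: F_def W_def pv_def split: if_splits)
  have disj: "set xs \<inter> W J = {}" using insert.hyps by (auto simp: setxs W_def)
  then have disjF: "set xs \<inter> \<Union>(F J) = {}" using FW by blast
  have "(0, 0) \<notin> set xs" by (auto simp: setxs)
  then have W0: "W J \<union> set xs - {(0, 0)} = (W J - {(0, 0)}) \<union> set xs" by blast
  have 1: "sigma (W J \<union> set xs) (F J \<union> seg_edges ((0, 0) # xs))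
      = fib (l j + 1) * sigma (W J) (F J) + fib (l j) * sigma (W J - {(0, 0)}) (F J)"
    using sigma_attach_path[OF fin two dist disj disjF] len by simp
  have "finite (W J - {(0, 0)})" "set xs \<inter> (W J - {(0, 0)}) = {}" using fin disj by auto
  from sigma_attach_path[OF this(1) two dist this(2) disjF]
  \<comment> \<open>With the centre deleted the new path is free and contributes a single
    factor.\<close>
  have 2: "sigma (W J \<union> set xs - {(0, 0)}) (F J \<union> seg_edges ((0, 0) # xs))
      = fib (l j + 2) * sigma (W J - {(0, 0)}) (F J)"
    unfolding W0 len by (simp add: numeral_2_eq_2 algebra_simps)
  show ?case
    unfolding W' F' 1 2 using insert.IH insert.hyps
    by (simp add: numeral_2_eq_2 algebra_simps)
qed

lemma sigma_U:
  assumes "i < length L" "L ! i \<ge> 3"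
  shows "sigma (U_verts i L) (U_edges i L) =
    fib (L ! i + 1) * (\<Prod>j\<in>{..<length L} - {i}. fib (L ! j + 2)) +
    fib (L ! i - 1) * (\<Prod>j\<in>{..<length L} - {i}. fib (L ! j + 1))"
proof -
  have "U_verts i L = {(0::nat, t) | t. t < L ! i} \<union>
      {(Suc j, t) | j t. j \<in> {..<length L} - {i} \<and> 1 \<le> t \<and> t \<le> L ! j}"
    unfolding U_verts_def by auto
  moreover have "U_edges i L = {{(0::nat, t), (0, (t + 1) mod (L ! i))} | t. t < L ! i} \<union>
      {{pv j t, pv j (t + 1)} | j t. j \<in> {..<length L} - {i} \<and> t < L ! j}"
    unfolding U_edges_def by auto
  ultimately show ?thesis
    using sigma_U_partial[OF assms(2), of "{..<length L} - {i}" "(!) L"] by simp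
qed

lemma U_edges_in_verts:
  assumes "L ! i \<ge> 3" "e \<in> U_edges i L"
  obtains u v where "e = {u, v}" "u \<in> U_verts i L" "v \<in> U_verts i L"
proof -
  consider t where "t < L ! i" "e = {(0, t), (0, (t + 1) mod (L ! i))}"
    | j t where "j < length L" "j \<noteq> i" "t < L ! j" "e = {pv j t, pv j (t + 1)}"
    using assms(2) unfolding U_edges_def Un_iff mem_Collect_eq by metis
  then show ?thesis
  proof cases
    case 1
    moreover have "(t + 1) mod (L ! i) < L ! i" using assms(1) by simp
    ultimately show ?thesis by (intro that[OF 1(2)]) (simp_all add: U_verts_def)
  next
    case 2
    have "(0, 0) \<in> U_verts i L" using assms(1) by (simp add: U_verts_def)
    then show ?thesis using 2(1-3) by (intro that[OF 2(4)]) (simp_all add: U_verts_def pv_def)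
  qed
qed

section \<open>Invariance of the index under isomorphism\<close>

text \<open>Independence is put into the language of pairs, in which \<open>graph_iso\<close> is
  formulated.\<close>

lemma sigma_eq_pairs:
  assumes "\<And>e. e \<in> E \<Longrightarrow> \<exists>u v. e = {u, v}"
  shows "sigma V E = card {S \<in> Pow V. \<forall>u\<in>S. \<forall>v\<in>S. {u, v} \<notin> E}"
proof -
  have "(\<forall>e\<in>E. \<not> e \<subseteq> S) \<longleftrightarrow> (\<forall>u\<in>S. \<forall>v\<in>S. {u, v} \<notin> E)" for S
  proof
    assume "\<forall>e\<in>E. \<not> e \<subseteq> S"
    then show "\<forall>u\<in>S. \<forall>v\<in>S. {u, v} \<notin> E"
      by (metis empty_subsetI insert_subset)
  next
    assume S: "\<forall>u\<in>S. \<forall>v\<in>S. {u, v} \<notin> E"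
    show "\<forall>e\<in>E. \<not> e \<subseteq> S"
    proof (intro ballI notI)
      fix e assume e: "e \<in> E" "e \<subseteq> S"
      then obtain u v where "e = {u, v}" using assms by blast
      then show False using S e by simp
    qed
  qed
  then show ?thesis by (simp add: sigma_def)
qed

text \<open>Taking images under the vertex bijection is a bijection between the independent
  sets.\<close>

lemma sigma_iso:
  assumes iso: "graph_iso V E V' E'"
    and "\<And>e. e \<in> E \<Longrightarrow> \<exists>u v. e = {u, v}" "\<And>e. e \<in> E' \<Longrightarrow> \<exists>u v. e = {u, v}"
  shows "sigma V E = sigma V' E'"
proof -
  obtain f where f: "bij_betw f V V'"
    and edges: "\<And>u v. u \<in> V \<Longrightarrow> v \<in> V \<Longrightarrow> {u, v} \<in> E \<longleftrightarrow> {f u, f v} \<in> E'"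
    using iso unfolding graph_iso_def by blast
  let ?A = "{S \<in> Pow V. \<forall>u\<in>S. \<forall>v\<in>S. {u, v} \<notin> E}"
  let ?B = "{S \<in> Pow V'. \<forall>u\<in>S. \<forall>v\<in>S. {u, v} \<notin> E'}"
  have bij: "bij_betw (image f) (Pow V) (Pow V')" using f by (rule bij_betw_Pow)
  have P: "(\<forall>u\<in>S. \<forall>v\<in>S. {u, v} \<notin> E) \<longleftrightarrow> (\<forall>u\<in>f ` S. \<forall>v\<in>f ` S. {u, v} \<notin> E')"
    if S: "S \<in> Pow V" for S
  proof -
    have "{u, v} \<in> E \<longleftrightarrow> {f u, f v} \<in> E'" if "u \<in> S" "v \<in> S" for u v
      using edges S that by (simp add: subset_iff)
    then show ?thesis by simp
  qed
  have image: "image f ` ?A = ?B"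
  proof
    show "image f ` ?A \<subseteq> ?B"
    proof
      fix T assume "T \<in> image f ` ?A"
      then obtain S where S: "S \<in> ?A" "T = f ` S" by (rule imageE)
      then have "T \<in> Pow V'" using bij_betwE[OF bij] by simp
      then show "T \<in> ?B" using S P[of S] by simp
    qed
    show "?B \<subseteq> image f ` ?A"
    proof
      fix T assume T: "T \<in> ?B"
      then have "T \<in> image f ` Pow V" using bij_betw_imp_surj_on[OF bij] by simp
      then obtain S where S: "S \<in> Pow V" "T = f ` S" by (rule imageE)
      then have "S \<in> ?A" using P[of S] T by simp
      then show "T \<in> image f ` ?A" using S(2) by simp
    qed
  qed
  have "inj_on (image f) ?A"
    using bij_betw_imp_inj_on[OF bij] by (rule inj_on_subset) (rule Collect_restrict)
  from card_image[OF this] have "card ?A = card ?B" unfolding image by simp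
  moreover have "sigma V E = card ?A" by (rule sigma_eq_pairs[OF assms(2)])
  moreover have "sigma V' E' = card ?B" by (rule sigma_eq_pairs[OF assms(3)])
  ultimately show ?thesis by simp
qed

section \<open>Comparing the graphs \<open>U\<^sub>i\<close>\<close>

text \<open>The convergents 0, 1, 1/2, 2/3, ... of the continued fraction of the inverse golden
  ratio.\<close>

definition fib_ratio :: "nat \<Rightarrow> real" where
  "fib_ratio n = fib n / fib (n + 1)"

lemma fib_ratio_nonneg: "fib_ratio n \<ge> 0"
  by (simp add: fib_ratio_def)

lemma fib_ratio_Suc: "fib_ratio (Suc n) = 1 / (1 + fib_ratio n)"
proof -
  have "real (fib (Suc n)) > 0" by (simp add: fib_neq_0_nat)
  then show ?thesis by (simp add: fib_ratio_def field_simps)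
qed

text \<open>The map sending \<open>x\<close> to \<open>1 / (1 + x)\<close> is decreasing on
  nonnegative reals, so each step exchanges lower and upper bounds together with the parity.\<close>

lemma fib_ratio_alternating:
  "m \<le> n \<Longrightarrow> (even m \<longrightarrow> fib_ratio m \<le> fib_ratio n) \<and> (odd m \<longrightarrow> fib_ratio n \<le> fib_ratio m)"
proof (induction m arbitrary: n)
  case 0
  then show ?case using fib_ratio_nonneg by (simp add: fib_ratio_def)
next
  case (Suc m)
  then obtain k where k: "n = Suc k" "m \<le> k" by (cases n) auto
  show ?case
    using Suc.IH[OF k(2)] fib_ratio_nonneg[of m] fib_ratio_nonneg[of k]
    unfolding k(1) fib_ratio_Suc by (auto intro!: divide_left_mono mult_pos_pos)
qed

text \<open>Taking \<open>P\<close> and \<open>Q\<close> over all segments makes them independent of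
  the choice of the cycle; its length \<open>l\<close> enters through
  \<open>fib (l + 1) / fib (l + 2)\<close> and \<open>fib (l - 1) / fib (l + 1)\<close>
  alone.\<close>

definition U_value :: "real \<Rightarrow> real \<Rightarrow> nat \<Rightarrow> real" where
  "U_value P Q l = P * fib_ratio (l + 1) + Q * (1 - fib_ratio l)"

lemma U_value_eq:
  assumes "l \<ge> 1"
  shows "real (fib (l + 1) * p + fib (l - 1) * q) = U_value (real (fib (l + 2) * p)) (real (fib (l + 1) * q)) l"
proof -
  obtain k where k: "l = Suc k" using assms by (cases l) auto
  define a b where "a = real (fib k)" and "b = real (fib (Suc k))"
  have ab: "a \<ge> 0" "b > 0" by (simp_all add: a_def b_def fib_neq_0_nat)
  have "U_value (real (fib (l + 2) * p)) (real (fib (l + 1) * q)) l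
      = (a + 2 * b) * p * ((a + b) / (a + 2 * b)) + (a + b) * q * (1 - b / (a + b))"
    by (simp add: U_value_def fib_ratio_def k a_def b_def numeral_2_eq_2 add_ac)
  also have "(a + 2 * b) * p * ((a + b) / (a + 2 * b)) = (a + b) * p"
    using ab by simp
  also have "(a + b) * q * (1 - b / (a + b)) = a * q"
    using ab by (simp add: field_simps)
  finally show ?thesis by (simp add: k a_def b_def)
qed

text \<open>The indices \<open>l\<close> and \<open>l + 1\<close> have opposite parity and their
  ratios enter with opposite signs, so both terms move in the same direction. Even lengths beat odd
  ones, short even ones beat long ones, and long odd ones beat short ones.\<close>

lemma U_value_mono:
  assumes "P \<ge> 0" "Q \<ge> 0"
    and "even b \<and> (odd a \<or> b \<le> a) \<or> odd a \<and> odd b \<and> a \<le> b"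
  shows "U_value P Q a \<le> U_value P Q b"
proof -
  have "fib_ratio (a + 1) \<le> fib_ratio (b + 1) \<and> fib_ratio b \<le> fib_ratio a"
    using assms(3) fib_ratio_alternating[of "a + 1" "b + 1"] fib_ratio_alternating[of "b + 1" "a + 1"]
      fib_ratio_alternating[of a b] fib_ratio_alternating[of b a]
    by (cases "a \<le> b") auto
  then show ?thesis unfolding U_value_def using assms(1,2) by (intro add_mono mult_left_mono) auto
qed

section \<open>From the segment sequence to the extremal graph\<close>

lemma segment_sequence_length:
  assumes "mset L = image_mset card (mset_set S)" "finite S"
  shows "s \<in> S \<Longrightarrow> \<exists>j<length L. L ! j = card s"
    and "j < length L \<Longrightarrow> \<exists>s\<in>S. card s = L ! j"
proof -
  have "set L = card ` S"
    using arg_cong[OF assms(1), of set_mset] assms(2) by simp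
  then show "s \<in> S \<Longrightarrow> \<exists>j<length L. L ! j = card s"
    and "j < length L \<Longrightarrow> \<exists>s\<in>S. card s = L ! j"
    by (metis in_set_conv_nth imageI, metis imageE nth_mem)
qed

lemma fib_prod_segment_sequence:
  assumes "mset L = image_mset card (mset_set S)"
  shows "(\<Prod>j<length L. fib (L ! j + k)) = fib_prod k S"
proof -
  have "mset L = image_mset ((!) L) (mset_set {..<length L})"
    by (metis atLeast_upt map_nth mset_map mset_upt lessThan_atLeast0)
  then have "image_mset (\<lambda>l. fib (l + k)) (image_mset ((!) L) (mset_set {..<length L}))
      = image_mset (\<lambda>l. fib (l + k)) (image_mset card (mset_set S))"
    using assms by simp
  from arg_cong[OF this, of prod_mset] show ?thesis
    by (simp add: fib_prod_def prod_unfold_prod_mset image_mset.compositionality comp_def)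
qed

lemma sigma_U_value:
  assumes "i < length L" "L ! i \<ge> 3"
  shows "real (sigma (U_verts i L) (U_edges i L)) =
    U_value (real (\<Prod>j<length L. fib (L ! j + 2))) (real (\<Prod>j<length L. fib (L ! j + 1))) (L ! i)"
proof -
  have remove: "(\<Prod>j<length L. fib (L ! j + k)) = fib (L ! i + k) * (\<Prod>j\<in>{..<length L} - {i}. fib (L ! j + k))" for k
    using assms(1) by (intro prod.remove) auto
  show ?thesis
    unfolding sigma_U[OF assms] remove using assms(2) by (intro U_value_eq) simp
qed

text \<open>The assumption \<open>best\<close> says that \<open>L ! i\<close> is top in the order of
  \<open>U_value_mono\<close> among the entries at least 3. A long segment on the cycle is compared
  with it through that order; without one, the exchange applies directly to a segment of length
  \<open>L ! i\<close>.\<close>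

lemma (in unicyclic_graph) sigma_le_sigma_U:
  assumes seq: "mset L = image_mset card (mset_set (segments E))"
    and i: "i < length L" "L ! i \<ge> 3"
    and best: "\<And>j. j < length L \<Longrightarrow> L ! j \<ge> 3 \<Longrightarrow>
      even (L ! i) \<and> (odd (L ! j) \<or> L ! i \<le> L ! j) \<or> odd (L ! j) \<and> odd (L ! i) \<and> L ! j \<le> L ! i"
  shows "sigma V E \<le> sigma (U_verts i L) (U_edges i L)"
proof -
  define P Q where "P = fib_prod 2 (segments E)" and "Q = fib_prod 1 (segments E)"
  have U: "real (sigma (U_verts i L) (U_edges i L)) = U_value P Q (L ! i)"
    using sigma_U_value[OF i] unfolding P_def Q_def fib_prod_segment_sequence[OF seq] .
  have attached: "real (fib (card s + 1) * fib_prod 2 (segments E - {s})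
      + fib (card s - 1) * fib_prod 1 (segments E - {s})) = U_value P Q (card s)"
    if "s \<in> segments E" "card s \<ge> 3" for s
  proof -
    have "fib_prod k (segments E) = fib (card s + k) * fib_prod k (segments E - {s})" for k
      unfolding fib_prod_def by (rule prod.remove[OF finite_segments that(1)])
    from this[of 2] this[of 1] show ?thesis
      unfolding P_def Q_def using U_value_eq[of "card s"] that(2) by simp
  qed
  have "real (sigma V E) \<le> U_value P Q (L ! i)"
  proof (cases "\<exists>s\<in>cycle_segments. card s \<ge> 3")
    case True
    then obtain s where s: "s \<in> cycle_segments" "card s \<ge> 3" by blast
    then have sS: "s \<in> segments E" using cycle_segments_subset by blast
    then obtain j where j: "j < length L" "L ! j = card s"
      using segment_sequence_length(1)[OF seq finite_segments] by blast
    have "real (sigma V E) \<le> U_value P Q (card s)"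
      using sigma_le_long_cycle_segment[OF s] unfolding attached[OF sS s(2), symmetric] by (rule of_nat_mono)
    also have "\<dots> \<le> U_value P Q (L ! i)"
      using best[OF j(1)] s(2) unfolding j(2) by (intro U_value_mono) auto
    finally show ?thesis .
  next
    case False
    then have short: "card s \<le> 2" if "s \<in> cycle_segments" for s using that by force
    obtain s where s: "s \<in> segments E" "card s = L ! i"
      using segment_sequence_length(2)[OF seq finite_segments i(1)] by blast
    then have "card s \<ge> 3" using i(2) by simp
    from sigma_le_short_cycle_segments[OF short s(1) this]
    show ?thesis unfolding s(2)[symmetric] attached[OF s(1) \<open>card s \<ge> 3\<close>, symmetric] by (rule of_nat_mono)
  qed
  then show ?thesis unfolding U[symmetric] by simp
qed

theorem theorem6:
  fixes L :: "nat list" and V :: "'a set" and E :: "'a set set"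
  assumes G: "in_U L V E"
    and L1: "L \<noteq> []" "L ! 0 \<ge> 3"
  shows "(\<forall>i0 < length L. even (L ! i0) \<and> L ! i0 \<ge> 3 \<and>
            (\<forall>j < length L. even (L ! j) \<and> L ! j \<ge> 3 \<longrightarrow> L ! i0 \<le> L ! j) \<longrightarrow>
            sigma (U_verts i0 L) (U_edges i0 L) \<ge> sigma V E \<and>
            (graph_iso V E (U_verts i0 L) (U_edges i0 L) \<longrightarrow>
               sigma (U_verts i0 L) (U_edges i0 L) = sigma V E))
       \<and> ((\<forall>j < length L. L ! j \<ge> 3 \<longrightarrow> odd (L ! j)) \<longrightarrow>
            sigma (U_verts 0 L) (U_edges 0 L) \<ge> sigma V E \<and>
            (graph_iso V E (U_verts 0 L) (U_edges 0 L) \<longrightarrow>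
               sigma (U_verts 0 L) (U_edges 0 L) = sigma V E))"
proof -
  have simple: "simple_graph V E" and connected: "connected_graph V E" and ex1: "\<exists>!C. is_cycle E C"
    and sorted: "sorted_wrt (\<ge>) L" and seq: "mset L = image_mset card (mset_set (segments E))"
    using G by (simp_all add: in_U_def unicyclic_def segment_sequence_def)
  obtain C where C: "is_cycle E C" "\<And>D. is_cycle E D \<Longrightarrow> D = C" using ex1 by blast
  \<comment> \<open>As \<open>L\<close> is nonempty a segment exists, and its first vertex is the
    branch vertex or leaf required by the locale.\<close>
  have "segments E \<noteq> {}" using seq L1(1) by auto
  then obtain p where p: "is_segment E p" unfolding segments_def by blast
  have "\<exists>b\<in>V. degree E b \<noteq> 2"
  proof
    have "length p \<ge> 2" "degree E (hd p) = 1 \<or> degree E (hd p) \<ge> 3"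
      using p unfolding is_segment_def by blast+
    then show "degree E (hd p) \<noteq> 2" by auto
    have "hd p \<in> \<Union>(seg_edges p)"
      unfolding Union_seg_edges[OF \<open>length p \<ge> 2\<close>] using \<open>length p \<ge> 2\<close> by (intro hd_in_set) auto
    then obtain e where "e \<in> seg_edges p" "hd p \<in> e" by (rule UnionE)
    then show "hd p \<in> V" using seg_edges_subset[OF p] simple_graph_subset[OF simple, of e] by blast
  qed
  then interpret unicyclic_graph V E C
    using simple connected C by unfold_locales
  have iso: "sigma (U_verts i L) (U_edges i L) = sigma V E"
    if "graph_iso V E (U_verts i L) (U_edges i L)" "L ! i \<ge> 3" for i
  proof -
    have "\<exists>u v. e = {u, v}" if "e \<in> E" for e
      using that simple unfolding simple_graph_def by blast
    moreover have "\<exists>u v. e = {u, v}" if "e \<in> U_edges i L" for e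
      using U_edges_in_verts[OF \<open>L ! i \<ge> 3\<close> that] by metis
    ultimately show ?thesis using sigma_iso[OF that(1)] by simp
  qed
  show ?thesis
  proof (intro conjI allI impI; (elim conjE)?)
    fix i0
    assume i: "i0 < length L" "even (L ! i0)" "3 \<le> L ! i0"
      "\<forall>j<length L. even (L ! j) \<and> 3 \<le> L ! j \<longrightarrow> L ! i0 \<le> L ! j"
    \<comment> \<open>Minimality among the even entries at least 3 gives the first alternative of
      \<open>best\<close>.\<close>
    show "sigma V E \<le> sigma (U_verts i0 L) (U_edges i0 L)"
      by (rule sigma_le_sigma_U[OF seq i(1,3)]) (use i(2,4) in blast)
    show "sigma (U_verts i0 L) (U_edges i0 L) = sigma V E"
      if "graph_iso V E (U_verts i0 L) (U_edges i0 L)"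
      using iso[OF that i(3)] .
  next
    assume odd: "\<forall>j<length L. 3 \<le> L ! j \<longrightarrow> odd (L ! j)"
    \<comment> \<open>Sortedness makes the first entry the largest, which is the best choice among
      odd lengths.\<close>
    have "L ! j \<le> L ! 0" if "j < length L" for j
      using sorted_wrt_nth_less[OF sorted _ that, of 0] by (cases "j = 0") auto
    moreover have "0 < length L" using L1(1) by simp
    ultimately show "sigma V E \<le> sigma (U_verts 0 L) (U_edges 0 L)"
      using odd L1(2) by (intro sigma_le_sigma_U[OF seq]) auto
    show "sigma (U_verts 0 L) (U_edges 0 L) = sigma V E"
      if "graph_iso V E (U_verts 0 L) (U_edges 0 L)"
      using iso[OF that L1(2)] .
  qed
qed

end
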